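(* Let $N\in\mathbb{N}$. The map $\iota_{Lio}:(\mathbb{R}^{2d})^N\to\mathfrak{g}_N^*$, $$\iota_{Lio}(\underline{z}_N):=\frac1{N!}\sum_{\pi\in\mathbb{S}_N}\delta_{z_{\pi(1)}}\otimes\cdots\otimes\delta_{z_{\pi(N)}},$$ belongs to $\mathcal{C}^\infty((\mathbb{R}^{2d})^N,\mathfrak{g}_N^* )$ and is a morphism of the Poisson vector space $((\mathbb{R}^{2d})^N,\{\cdot,\cdot\}_N)$ into the Lie-Poisson space $(\mathfrak{g}_N^*,\{\cdot,\cdot\}_{\mathfrak{g}_N^*})$: $$\forall\mathcal{F},\mathcal{G}\in\mathcal{C}^\infty(\mathfrak{g}_N^* ),\qquad\{\iota_{Lio}^*\mathcal{F},\iota_{Lio}^*\mathcal{G}\}_N=\iota_{Lio}^*\{\mathcal{F},\mathcal{G}\}_{\mathfrak{g}_N^*},$$ where $\iota_{Lio}^*$ denotes the pullback, $\iota_{Lio}^*\mathcal{F}=\mathcal{F}\circ\iota_{Lio}$.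
   Context: Fix $d\in\mathbb{N}$. Points of $\mathbb{R}^{2d}$ are $z=(x,v)$; $\underline{z}_N=(z_1,\dots,z_N)$; $\mathbb{S}_N$ is the symmetric group; $\delta_z$ is the Dirac mass. For smooth $F,G$ on $(\mathbb{R}^{2d})^N$, $\{F,G\}_N:=N\sum_{i=1}^N(\nabla_{x_i}F\cdot\nabla_{v_i}G-\nabla_{v_i}F\cdot\nabla_{x_i}G)$. $\mathfrak{g}_N$ is the real vector space of smooth functions $f:(\mathbb{R}^{2d})^N\to\mathbb{R}$ invariant under permutations of $z_1,\dots,z_N$, with the topology generated by the seminorms $\sup_{|\alpha|\le n}\|\partial^\alpha f\|_{L^\infty(K)}$ ($K$ compact, $n\in\mathbb{N}$), and $[f,g]_{\mathfrak{g}_N}:=\{f,g\}_N$. $\mathfrak{g}_N^*$ is its strong dual (permutation-invariant compactly supported distributions); $\mathfrak{g}_N$ is reflexive, so for $\mathcal{F}\in\mathcal{C}^\infty(\mathfrak{g}_N^* )$ the Gâteaux derivative $\mathrm{d}\mathcal{F}[\gamma]\in\mathfrak{g}_N^{**}$ is identified with an element of $\mathfrak{g}_N$. Smoothness is in the Gâteaux sense: all iterated directional derivatives $\mathrm{d}^nf:X\times X^n\to Y$ exist and are jointly continuous. $\{\mathcal{F},\mathcal{G}\}_{\mathfrak{g}_N^*}(\gamma):=\langle[\mathrm{d}\mathcal{F}[\gamma],\mathrm{d}\mathcal{G}[\gamma]]_{\mathfrak{g}_N},\gamma\rangle_{\mathfrak{g}_N-\mathfrak{g}_N^*}$. *)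

theory Defs
  imports "HOL-Analysis.Analysis"
begin

section \<open>Topological vector spaces and topologies generated by seminorms\<close>

text \<open>Hausdorff real topological vector spaces.\<close>

class real_tvs = real_vector + topological_ab_group_add + t2_space +
  assumes tendsto_scaleR_nhds:
    "((\<lambda>(c, x). c *\<^sub>R x) \<longlongrightarrow> a *\<^sub>R b) (nhds (a::real) \<times>\<^sub>F nhds b)"

instance real_normed_vector < real_tvs
proof
  fix a :: real and b :: 'a
  show "((\<lambda>(c, x). c *\<^sub>R x) \<longlongrightarrow> a *\<^sub>R b) (nhds a \<times>\<^sub>F nhds b)"
    unfolding case_prod_unfold
    by (intro tendsto_scaleR filterlim_fst filterlim_snd)
qed

lemma tendsto_scaleR_tvs:
  fixes g :: "'b \<Rightarrow> 'a::real_tvs"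
  assumes "(f \<longlongrightarrow> a) F" "(g \<longlongrightarrow> b) F"
  shows "((\<lambda>x. f x *\<^sub>R g x) \<longlongrightarrow> a *\<^sub>R b) F"
  using filterlim_compose[OF tendsto_scaleR_nhds filterlim_Pair[OF assms]] by simp

definition is_seminorm :: "('a::real_vector \<Rightarrow> real) \<Rightarrow> bool" where
  "is_seminorm p \<longleftrightarrow> (\<forall>x y. p (x + y) \<le> p x + p y) \<and> (\<forall>c x. p (c *\<^sub>R x) = \<bar>c\<bar> * p x)"

text \<open>The open sets of the topology generated by the family \<open>(p i)\<close>, \<open>i \<in> I\<close>, of seminorms;
  the family need not be directed, whence the finite sets of indices.\<close>

definition seminorm_open :: "'i set \<Rightarrow> ('i \<Rightarrow> 'a::real_vector \<Rightarrow> real) \<Rightarrow> 'a set \<Rightarrow> bool" where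
  "seminorm_open I p U \<longleftrightarrow>
     (\<forall>x\<in>U. \<exists>J e. finite J \<and> J \<subseteq> I \<and> 0 < e \<and> {y. \<forall>i\<in>J. p i (y - x) < e} \<subseteq> U)"

lemma seminorm_openE:
  assumes "seminorm_open I p U" "x \<in> U"
  obtains J e where "finite J" "J \<subseteq> I" "0 < e" "\<forall>y. (\<forall>i\<in>J. p i (y - x) < e) \<longrightarrow> y \<in> U"
proof -
  from bspec[OF assms(1)[unfolded seminorm_open_def] assms(2)]
  obtain J e where *: "finite J" "J \<subseteq> I" "0 < e" "{y. \<forall>i\<in>J. p i (y - x) < e} \<subseteq> U"
    by (elim exE conjE)
  show thesis
    by (rule that[OF *(1-3)]) (use *(4) in \<open>simp add: subset_iff\<close>)
qed

lemma seminorm_openI: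
  assumes "\<And>x. x \<in> U \<Longrightarrow> \<exists>J e. finite J \<and> J \<subseteq> I \<and> 0 < e \<and> (\<forall>y. (\<forall>i\<in>J. p i (y - x) < e) \<longrightarrow> y \<in> U)"
  shows "seminorm_open I p U"
  using assms unfolding seminorm_open_def subset_iff mem_Collect_eq by simp

lemma is_seminorm_zero: "is_seminorm p \<Longrightarrow> p 0 = 0"
  unfolding is_seminorm_def by (metis abs_zero mult_zero_left scaleR_zero_left)

lemma is_seminorm_minus: "is_seminorm p \<Longrightarrow> p (- x) = p x"
  unfolding is_seminorm_def
  by (metis abs_minus_cancel abs_one mult_1 scaleR_minus1_left)

lemma is_seminorm_nonneg:
  assumes "is_seminorm p" shows "0 \<le> p x"
proof -
  have "p (x + - x) \<le> p x + p (- x)" using assms unfolding is_seminorm_def by blast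
  then show ?thesis using is_seminorm_zero[OF assms] is_seminorm_minus[OF assms, of x] by simp
qed

lemma seminorm_open_UNIV: "seminorm_open I p UNIV"
  by (rule seminorm_openI) (auto intro!: exI[of _ "{}"] exI[of _ "1::real"])

lemma seminorm_open_Int:
  assumes "seminorm_open I p U" "seminorm_open I p V"
  shows "seminorm_open I p (U \<inter> V)"
proof (rule seminorm_openI)
  fix x assume x: "x \<in> U \<inter> V"
  obtain J e where J: "finite J" "J \<subseteq> I" "0 < e"
      "\<forall>y. (\<forall>i\<in>J. p i (y - x) < e) \<longrightarrow> y \<in> U"
    by (rule seminorm_openE[OF assms(1) IntD1[OF x]])
  obtain J' e' where J': "finite J'" "J' \<subseteq> I" "0 < e'"
      "\<forall>y. (\<forall>i\<in>J'. p i (y - x) < e') \<longrightarrow> y \<in> V"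
    by (rule seminorm_openE[OF assms(2) IntD2[OF x]])
  show "\<exists>J e. finite J \<and> J \<subseteq> I \<and> 0 < e \<and> (\<forall>y. (\<forall>i\<in>J. p i (y - x) < e) \<longrightarrow> y \<in> U \<inter> V)"
    using J(1-3) J'(1-3)
    by (intro exI[of _ "J \<union> J'"] exI[of _ "min e e'"]) (auto intro!: J(4)[rule_format] J'(4)[rule_format])
qed

lemma seminorm_open_Union:
  assumes "\<forall>U\<in>K. seminorm_open I p U"
  shows "seminorm_open I p (\<Union>K)"
proof (rule seminorm_openI)
  fix x assume "x \<in> \<Union>K"
  then obtain U where U: "U \<in> K" "x \<in> U" by (elim UnionE)
  obtain J e where J: "finite J" "J \<subseteq> I" "0 < e"
      "\<forall>y. (\<forall>i\<in>J. p i (y - x) < e) \<longrightarrow> y \<in> U"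
    by (rule seminorm_openE[OF bspec[OF assms U(1)] U(2)])
  show "\<exists>J e. finite J \<and> J \<subseteq> I \<and> 0 < e \<and> (\<forall>y. (\<forall>i\<in>J. p i (y - x) < e) \<longrightarrow> y \<in> \<Union>K)"
    using J(1-3) J(4)[rule_format, THEN UnionI[OF U(1)]]
    by (intro exI[of _ J] exI[of _ e] conjI allI impI) auto
qed

lemma seminorm_open_ball:
  assumes "\<And>i. i \<in> I \<Longrightarrow> is_seminorm (p i)" "i \<in> I"
  shows "seminorm_open I p {y. p i (y - a) < e}"
proof (rule seminorm_openI)
  fix x assume x: "x \<in> {y. p i (y - a) < e}"
  have "p i (y - a) < e" if "p i (y - x) < e - p i (x - a)" for y
  proof -
    have "p i ((y - x) + (x - a)) \<le> p i (y - x) + p i (x - a)"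
      using assms(1)[OF assms(2)] unfolding is_seminorm_def by blast
    then show ?thesis using that by simp
  qed
  then show "\<exists>J e'. finite J \<and> J \<subseteq> I \<and> 0 < e' \<and>
      (\<forall>y. (\<forall>j\<in>J. p j (y - x) < e') \<longrightarrow> y \<in> {y. p i (y - a) < e})"
    using x assms(2) by (intro exI[of _ "{i}"] exI[of _ "e - p i (x - a)"]) auto
qed

lemma tendsto_seminorm_iff:
  fixes f :: "'b \<Rightarrow> 'a::{real_vector,topological_space}"
  assumes op: "\<And>U::'a set. open U \<longleftrightarrow> seminorm_open I p U"
    and sn: "\<And>i. i \<in> I \<Longrightarrow> is_seminorm (p i)"
  shows "(f \<longlongrightarrow> l) F \<longleftrightarrow> (\<forall>i\<in>I. ((\<lambda>x. p i (f x - l)) \<longlongrightarrow> 0) F)"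
proof (intro iffI ballI)
  fix i assume f: "(f \<longlongrightarrow> l) F" and i: "i \<in> I"
  show "((\<lambda>x. p i (f x - l)) \<longlongrightarrow> 0) F"
  proof (rule order_tendstoI)
    fix a :: real assume "a < 0"
    then have "a < p i (f x - l)" for x
      using is_seminorm_nonneg[OF sn[OF i], of "f x - l"] by linarith
    then show "\<forall>\<^sub>F x in F. a < p i (f x - l)" by simp
  next
    fix a :: real assume a: "0 < a"
    have "open {y. p i (y - l) < a}"
      unfolding op by (rule seminorm_open_ball[OF sn i])
    moreover have "l \<in> {y. p i (y - l) < a}"
      using a is_seminorm_zero[OF sn[OF i]] by simp
    ultimately show "\<forall>\<^sub>F x in F. p i (f x - l) < a"
      using topological_tendstoD[OF f] by fastforce
  qed
next
  assume lim: "\<forall>i\<in>I. ((\<lambda>x. p i (f x - l)) \<longlongrightarrow> 0) F"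
  show "(f \<longlongrightarrow> l) F"
  proof (rule topological_tendstoI)
    fix U :: "'a set" assume "open U" "l \<in> U"
    then obtain J e where J: "finite J" "J \<subseteq> I" "0 < e"
        "\<forall>y. (\<forall>i\<in>J. p i (y - l) < e) \<longrightarrow> y \<in> U"
      unfolding op using seminorm_openE by metis
    have "\<forall>\<^sub>F x in F. \<forall>i\<in>J. p i (f x - l) < e"
      using J(1-3) lim by (intro eventually_ball_finite ballI order_tendstoD(2)[of _ 0]) auto
    then show "\<forall>\<^sub>F x in F. f x \<in> U"
      by (rule eventually_mono) (simp add: J(4))
  qed
qed

lemma OFCLASS_real_tvs_seminorms:
  fixes p :: "'i \<Rightarrow> 'a::{real_vector,topological_space} \<Rightarrow> real"
  assumes op: "\<And>U::'a set. open U \<longleftrightarrow> seminorm_open I p U"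
    and sn: "\<And>i. i \<in> I \<Longrightarrow> is_seminorm (p i)"
    and sep: "\<And>x. x \<noteq> 0 \<Longrightarrow> \<exists>i\<in>I. p i x \<noteq> 0"
  shows "OFCLASS('a, real_tvs_class)"
proof
  have lim: "(f \<longlongrightarrow> l) F \<longleftrightarrow> (\<forall>i\<in>I. ((\<lambda>x. p i (f x - l)) \<longlongrightarrow> 0) F)"
    for f :: "'z \<Rightarrow> 'a" and l F
    by (rule tendsto_seminorm_iff[OF op sn])
  have tri: "p i (x + y) \<le> p i x + p i y" if "i \<in> I" for i x y
    using sn[OF that] unfolding is_seminorm_def by blast
  have hom: "p i (c *\<^sub>R x) = \<bar>c\<bar> * p i x" if "i \<in> I" for i c x
    using sn[OF that] unfolding is_seminorm_def by blast
  have nn: "0 \<le> p i x" if "i \<in> I" for i x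
    by (rule is_seminorm_nonneg[OF sn[OF that]])
  have fst0: "((\<lambda>x. p i (fst x - a)) \<longlongrightarrow> 0) (nhds a \<times>\<^sub>F G)"
    and snd0: "((\<lambda>x. p i (snd x - a)) \<longlongrightarrow> 0) (G \<times>\<^sub>F nhds a)" if "i \<in> I" for i a and G :: "'z filter"
  proof -
    have "(fst \<longlongrightarrow> a) (nhds a \<times>\<^sub>F G)" by (rule filterlim_fst)
    then show "((\<lambda>x. p i (fst x - a)) \<longlongrightarrow> 0) (nhds a \<times>\<^sub>F G)"
      using that unfolding lim by (rule bspec)
    have "(snd \<longlongrightarrow> a) (G \<times>\<^sub>F nhds a)" by (rule filterlim_snd)
    then show "((\<lambda>x. p i (snd x - a)) \<longlongrightarrow> 0) (G \<times>\<^sub>F nhds a)"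
      using that unfolding lim by (rule bspec)
  qed
  show "((\<lambda>x. fst x + snd x) \<longlongrightarrow> a + b) (nhds a \<times>\<^sub>F nhds b)" for a b :: 'a
    unfolding lim
  proof
    fix i assume i: "i \<in> I"
    have b: "\<bar>p i (fst x + snd x - (a + b))\<bar> \<le> p i (fst x - a) + p i (snd x - b)" for x
      using tri[OF i, of "fst x - a" "snd x - b"] nn[OF i] by (simp add: algebra_simps)
    have "((\<lambda>x. p i (fst x - a) + p i (snd x - b)) \<longlongrightarrow> 0) (nhds a \<times>\<^sub>F nhds b)"
      using tendsto_add[OF fst0[OF i, of a "nhds b"] snd0[OF i, of b "nhds a"]] by simp
    then show "((\<lambda>x. p i (fst x + snd x - (a + b))) \<longlongrightarrow> 0) (nhds a \<times>\<^sub>F nhds b)"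
      by (rule Lim_null_comparison[rotated]) (simp add: b)
  qed
  show "(uminus \<longlongrightarrow> - a) (nhds a)" for a :: 'a
    unfolding lim
  proof
    fix i assume i: "i \<in> I"
    have "((\<lambda>x. x) \<longlongrightarrow> a) (nhds a)" by (simp add: filterlim_def)
    then have "((\<lambda>x. p i (x - a)) \<longlongrightarrow> 0) (nhds a)"
      using i unfolding lim by (rule bspec)
    moreover have "p i (- x - - a) = p i (x - a)" for x
      using is_seminorm_minus[OF sn[OF i], of "x - a"] by simp
    ultimately show "((\<lambda>x. p i (- x - - a)) \<longlongrightarrow> 0) (nhds a)" by simp
  qed
  show "\<exists>U V. open U \<and> open V \<and> x \<in> U \<and> y \<in> V \<and> U \<inter> V = {}" if "x \<noteq> y" for x y :: 'a
  proof -
    obtain i where i: "i \<in> I" and ne: "p i (x - y) \<noteq> 0" using sep[of "x - y"] \<open>x \<noteq> y\<close> by auto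
    define e where "e = p i (x - y) / 2"
    have e: "0 < e" unfolding e_def using ne nn[OF i, of "x - y"] by linarith
    have "{z. p i (z - x) < e} \<inter> {z. p i (z - y) < e} = {}"
    proof (rule ccontr)
      assume "\<not> ?thesis"
      then obtain z where z: "p i (z - x) < e" "p i (z - y) < e" by blast
      have "p i (x - y) \<le> p i (x - z) + p i (z - y)" using tri[OF i, of "x - z" "z - y"] by simp
      moreover have "p i (x - z) = p i (z - x)"
        using is_seminorm_minus[OF sn[OF i], of "z - x"] by simp
      ultimately show False using z unfolding e_def by linarith
    qed
    moreover have "open {z. p i (z - w) < e}" for w
      unfolding op by (rule seminorm_open_ball[OF sn i])
    moreover have "w \<in> {z. p i (z - w) < e}" for w
      using e is_seminorm_zero[OF sn[OF i]] by simp
    ultimately show ?thesis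
      by (intro exI[of _ "{z. p i (z - x) < e}"] exI[of _ "{z. p i (z - y) < e}"]) simp
  qed
  show "((\<lambda>(c, x). c *\<^sub>R x) \<longlongrightarrow> a *\<^sub>R b) (nhds a \<times>\<^sub>F nhds b)" for a :: real and b :: 'a
    unfolding lim
  proof
    fix i assume i: "i \<in> I"
    have b: "\<bar>p i ((case x of (c, x) \<Rightarrow> c *\<^sub>R x) - a *\<^sub>R b)\<bar>
        \<le> \<bar>fst x\<bar> * p i (snd x - b) + \<bar>fst x - a\<bar> * p i b" for x
    proof -
      have "(case x of (c, x) \<Rightarrow> c *\<^sub>R x) - a *\<^sub>R b = fst x *\<^sub>R (snd x - b) + (fst x - a) *\<^sub>R b"
        by (simp add: case_prod_unfold algebra_simps)
      then show ?thesis
        using tri[OF i, of "fst x *\<^sub>R (snd x - b)" "(fst x - a) *\<^sub>R b"] nn[OF i]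
        by (simp add: hom[OF i])
    qed
    have f: "(fst \<longlongrightarrow> a) (nhds a \<times>\<^sub>F nhds b)" by (rule filterlim_fst)
    have "((\<lambda>x. \<bar>fst x\<bar> * p i (snd x - b) + \<bar>fst x - a\<bar> * p i b)
        \<longlongrightarrow> \<bar>a\<bar> * 0 + \<bar>a - a\<bar> * p i b) (nhds a \<times>\<^sub>F nhds b)"
      by (intro tendsto_intros f snd0 i)
    then have "((\<lambda>x. \<bar>fst x\<bar> * p i (snd x - b) + \<bar>fst x - a\<bar> * p i b) \<longlongrightarrow> 0)
        (nhds a \<times>\<^sub>F nhds b)" by simp
    then show "((\<lambda>x. p i ((case x of (c, x) \<Rightarrow> c *\<^sub>R x) - a *\<^sub>R b)) \<longlongrightarrow> 0) (nhds a \<times>\<^sub>F nhds b)"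
      by (rule Lim_null_comparison[rotated]) (simp add: b)
  qed
qed


section \<open>Strong duals\<close>

text \<open>Boundedness in the sense of topological vector spaces: \<open>B\<close> is absorbed by every
  neighbourhood of the origin.\<close>

definition tvs_bounded :: "'a::real_tvs set \<Rightarrow> bool" where
  "tvs_bounded B \<longleftrightarrow>
     (\<forall>U. open U \<and> 0 \<in> U \<longrightarrow> (\<exists>r>0. \<forall>s\<ge>r. B \<subseteq> (\<lambda>x. s *\<^sub>R x) ` U))"

typedef (overloaded) ('a::real_tvs) dual =
  "{\<phi> :: 'a \<Rightarrow> real. linear \<phi> \<and> continuous_on UNIV \<phi>}"
  morphisms pairing Abs_dual
  by (rule exI[of _ "\<lambda>_. 0"]) (simp add: linear_zero)

setup_lifting type_definition_dual

lemma dual_eqI: "(\<And>x. pairing \<phi> x = pairing \<psi> x) \<Longrightarrow> \<phi> = \<psi>"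
  by (rule pairing_inject[THEN iffD1]) (rule ext)

lemma linear_cmult: "linear \<phi> \<Longrightarrow> linear (\<lambda>x. c * \<phi> x :: real)"
  using linear_compose_scale_right[of \<phi> c] by simp

instantiation dual :: (real_tvs) real_vector
begin

lift_definition zero_dual :: "'a dual" is "\<lambda>_. 0" by (simp add: linear_zero)
lift_definition plus_dual :: "'a dual \<Rightarrow> 'a dual \<Rightarrow> 'a dual" is "\<lambda>\<phi> \<psi> x. \<phi> x + \<psi> x"
  by (simp add: linear_compose_add continuous_on_add)
lift_definition minus_dual :: "'a dual \<Rightarrow> 'a dual \<Rightarrow> 'a dual" is "\<lambda>\<phi> \<psi> x. \<phi> x - \<psi> x"
  by (simp add: linear_compose_sub continuous_on_diff)
lift_definition uminus_dual :: "'a dual \<Rightarrow> 'a dual" is "\<lambda>\<phi> x. - \<phi> x"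
  by (simp add: linear_compose_neg continuous_on_minus)
lift_definition scaleR_dual :: "real \<Rightarrow> 'a dual \<Rightarrow> 'a dual" is "\<lambda>c \<phi> x. c * \<phi> x"
  by (intro conjI linear_cmult continuous_on_mult_left; elim conjE)

instance
  by intro_classes
    (simp_all add: dual_eqI zero_dual.rep_eq plus_dual.rep_eq minus_dual.rep_eq uminus_dual.rep_eq
      scaleR_dual.rep_eq algebra_simps)

end

text \<open>The strong topology: uniform convergence on bounded sets.\<close>

definition dual_seminorm :: "'a::real_tvs set \<Rightarrow> 'a dual \<Rightarrow> real" where
  "dual_seminorm B \<phi> = (SUP x\<in>B. \<bar>pairing \<phi> x\<bar>)"

instantiation dual :: (real_tvs) topological_space
begin

definition open_dual :: "'a dual set \<Rightarrow> bool" where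
  "open_dual = seminorm_open {B. tvs_bounded B \<and> B \<noteq> {}} dual_seminorm"

instance
  by standard (auto simp: open_dual_def intro: seminorm_open_UNIV seminorm_open_Int seminorm_open_Union)

end

lemma SUP_abs_is_seminorm:
  fixes q :: "'a::real_vector \<Rightarrow> 'b \<Rightarrow> real"
  assumes "B \<noteq> {}" "\<And>x. bdd_above ((\<lambda>b. \<bar>q x b\<bar>) ` B)"
    "\<And>x y b. b \<in> B \<Longrightarrow> q (x + y) b = q x b + q y b"
    "\<And>c x b. b \<in> B \<Longrightarrow> q (c *\<^sub>R x) b = c * q x b"
  shows "is_seminorm (\<lambda>x. SUP b\<in>B. \<bar>q x b\<bar>)"
  unfolding is_seminorm_def
proof (intro conjI allI)
  fix x y
  show "(SUP b\<in>B. \<bar>q (x + y) b\<bar>) \<le> (SUP b\<in>B. \<bar>q x b\<bar>) + (SUP b\<in>B. \<bar>q y b\<bar>)"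
  proof (rule cSUP_least[OF assms(1)])
    fix b assume b: "b \<in> B"
    have "\<bar>q (x + y) b\<bar> \<le> \<bar>q x b\<bar> + \<bar>q y b\<bar>" using assms(3)[OF b] by simp
    also have "\<dots> \<le> (SUP b\<in>B. \<bar>q x b\<bar>) + (SUP b\<in>B. \<bar>q y b\<bar>)"
      by (intro add_mono cSUP_upper b assms)
    finally show "\<bar>q (x + y) b\<bar> \<le> (SUP b\<in>B. \<bar>q x b\<bar>) + (SUP b\<in>B. \<bar>q y b\<bar>)" .
  qed
next
  fix c x
  have le: "(SUP b\<in>B. \<bar>q (c *\<^sub>R x) b\<bar>) \<le> \<bar>c\<bar> * (SUP b\<in>B. \<bar>q x b\<bar>)" for c x
  proof (rule cSUP_least[OF assms(1)])
    fix b assume b: "b \<in> B"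
    show "\<bar>q (c *\<^sub>R x) b\<bar> \<le> \<bar>c\<bar> * (SUP b\<in>B. \<bar>q x b\<bar>)"
      unfolding assms(4)[OF b] abs_mult by (intro mult_left_mono cSUP_upper b assms) simp
  qed
  show "(SUP b\<in>B. \<bar>q (c *\<^sub>R x) b\<bar>) = \<bar>c\<bar> * (SUP b\<in>B. \<bar>q x b\<bar>)"
  proof (cases "c = 0")
    case True
    have "q (0 *\<^sub>R x) b = 0" if "b \<in> B" for b using assms(4)[OF that, of 0 x] by simp
    then have "(\<lambda>b. \<bar>q (c *\<^sub>R x) b\<bar>) ` B = {0}" using True assms(1) by auto
    then show ?thesis using True by simp
  next
    case False
    have "\<bar>c\<bar> * (SUP b\<in>B. \<bar>q x b\<bar>) = \<bar>c\<bar> * (SUP b\<in>B. \<bar>q (inverse c *\<^sub>R (c *\<^sub>R x)) b\<bar>)"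
      using False by simp
    also have "\<dots> \<le> \<bar>c\<bar> * (\<bar>inverse c\<bar> * (SUP b\<in>B. \<bar>q (c *\<^sub>R x) b\<bar>))"
      by (intro mult_left_mono le) simp
    also have "\<dots> = (SUP b\<in>B. \<bar>q (c *\<^sub>R x) b\<bar>)" using False by simp
    finally show ?thesis using le[of c x] by linarith
  qed
qed

lemma pairing_linear: "linear (pairing \<phi>)" and pairing_continuous: "continuous_on UNIV (pairing \<phi>)"
  using pairing[of \<phi>] by auto

lemma pairing_bdd_above:
  assumes "tvs_bounded B"
  shows "bdd_above ((\<lambda>x. \<bar>pairing \<phi> x\<bar>) ` B)"
proof -
  let ?U = "pairing \<phi> -` ball 0 1"
  have "open ?U" using open_vimage[OF open_ball pairing_continuous] .
  moreover have "0 \<in> ?U" using linear_0[OF pairing_linear[of \<phi>]] by simp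
  ultimately have "\<exists>r>0. \<forall>s\<ge>r. B \<subseteq> (\<lambda>x. s *\<^sub>R x) ` ?U"
    by (intro assms[unfolded tvs_bounded_def, rule_format] conjI)
  then obtain r where "r > 0" "\<forall>s\<ge>r. B \<subseteq> (\<lambda>x. s *\<^sub>R x) ` ?U"
    by (elim exE conjE)
  then have r: "r > 0" "B \<subseteq> (\<lambda>x. r *\<^sub>R x) ` ?U" by auto
  have "\<bar>pairing \<phi> x\<bar> \<le> r" if x: "x \<in> B" for x
  proof -
    obtain y where y: "x = r *\<^sub>R y" "\<bar>pairing \<phi> y\<bar> < 1"
      using subsetD[OF r(2) x] by (auto simp del: scaleR_cancel_left)
    have "pairing \<phi> x = r * pairing \<phi> y" using linear_scale[OF pairing_linear[of \<phi>], of r y] y(1) by simp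
    then show ?thesis using y(2) r(1) by (simp add: abs_mult mult_left_le)
  qed
  then show ?thesis by (intro bdd_aboveI2)
qed

lemma tvs_bounded_singleton: "tvs_bounded {x :: 'a::real_tvs}"
  unfolding tvs_bounded_def
proof (intro allI impI)
  fix U :: "'a set" assume U: "open U \<and> 0 \<in> U"
  have "((\<lambda>s. inverse s *\<^sub>R x) \<longlongrightarrow> 0 *\<^sub>R x) (at_top :: real filter)"
    by (intro tendsto_scaleR_tvs tendsto_inverse_0_at_top filterlim_ident tendsto_const)
  then have "\<forall>\<^sub>F s in at_top. inverse s *\<^sub>R x \<in> U"
    by (rule topological_tendstoD) (use U in auto)
  then obtain r where r: "\<And>s. s \<ge> r \<Longrightarrow> inverse s *\<^sub>R x \<in> U"
    unfolding eventually_at_top_linorder by blast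
  have "x \<in> (\<lambda>x. s *\<^sub>R x) ` U" if "s \<ge> max r 1" for s
    using r[of s] that by (intro image_eqI[of _ _ "inverse s *\<^sub>R x"]) auto
  then show "\<exists>r>0. \<forall>s\<ge>r. {x} \<subseteq> (\<lambda>x. s *\<^sub>R x) ` U"
    by (intro exI[of _ "max r 1"]) auto
qed

lemma dual_seminorm_is_seminorm:
  "tvs_bounded B \<Longrightarrow> B \<noteq> {} \<Longrightarrow> is_seminorm (dual_seminorm B)"
  unfolding dual_seminorm_def[abs_def]
  by (rule SUP_abs_is_seminorm)
     (auto intro: pairing_bdd_above simp: plus_dual.rep_eq scaleR_dual.rep_eq)

instance dual :: (real_tvs) real_tvs
proof (rule OFCLASS_real_tvs_seminorms)
  show "open U \<longleftrightarrow> seminorm_open {B. tvs_bounded B \<and> B \<noteq> {}} dual_seminorm U" for U :: "'a dual set"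
    by (simp add: open_dual_def)
  show "is_seminorm (dual_seminorm B)" if "B \<in> {B. tvs_bounded B \<and> B \<noteq> {}}" for B :: "'a set"
    using that by (simp add: dual_seminorm_is_seminorm)
  show "\<exists>B\<in>{B. tvs_bounded B \<and> B \<noteq> {}}. dual_seminorm B \<phi> \<noteq> 0" if "\<phi> \<noteq> 0" for \<phi> :: "'a dual"
  proof -
    obtain x where "pairing \<phi> x \<noteq> 0"
      using \<open>\<phi> \<noteq> 0\<close> pairing_inject[of \<phi> 0] by (auto simp: fun_eq_iff zero_dual.rep_eq)
    then show ?thesis
      by (intro bexI[of _ "{x}"]) (auto simp: dual_seminorm_def tvs_bounded_singleton)
  qed
qed

lemma tendsto_dual_iff:
  fixes f :: "'b \<Rightarrow> 'a::real_tvs dual"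
  shows "(f \<longlongrightarrow> l) F \<longleftrightarrow>
    (\<forall>B\<in>{B. tvs_bounded B \<and> B \<noteq> {}}. ((\<lambda>x. dual_seminorm B (f x - l)) \<longlongrightarrow> 0) F)"
proof (rule tendsto_seminorm_iff)
  show "open U \<longleftrightarrow> seminorm_open {B. tvs_bounded B \<and> B \<noteq> {}} dual_seminorm U" for U :: "'a dual set"
    by (simp add: open_dual_def)
  show "is_seminorm (dual_seminorm B)" if "B \<in> {B. tvs_bounded B \<and> B \<noteq> {}}" for B :: "'a set"
    using that by (simp add: dual_seminorm_is_seminorm)
qed

text \<open>The canonical map into the bidual.\<close>

lemma pairing_evaluation_continuous:
  "continuous_on UNIV (\<lambda>\<phi>. pairing \<phi> (x :: 'a::real_tvs))"
  unfolding continuous_on_def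
proof
  fix \<phi> :: "'a dual"
  have "((\<lambda>\<psi>. \<psi>) \<longlongrightarrow> \<phi>) (at \<phi> within UNIV)" by (rule tendsto_ident_at)
  then have "((\<lambda>\<psi>. dual_seminorm {x} (\<psi> - \<phi>)) \<longlongrightarrow> 0) (at \<phi> within UNIV)"
    unfolding tendsto_dual_iff by (rule bspec) (simp add: tvs_bounded_singleton)
  then have "((\<lambda>\<psi>. \<bar>pairing \<psi> x - pairing \<phi> x\<bar>) \<longlongrightarrow> 0) (at \<phi> within UNIV)"
    by (simp add: dual_seminorm_def minus_dual.rep_eq)
  then show "((\<lambda>\<psi>. pairing \<psi> x) \<longlongrightarrow> pairing \<phi> x) (at \<phi> within UNIV)"
    by (simp only: tendsto_rabs_zero_iff LIM_zero_iff)
qed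

lift_definition to_bidual :: "'a::real_tvs \<Rightarrow> 'a dual dual" is "\<lambda>x \<phi>. pairing \<phi> x"
  by (auto intro!: linearI pairing_evaluation_continuous simp: plus_dual.rep_eq scaleR_dual.rep_eq)

text \<open>For a reflexive space this is the inverse of the canonical map.\<close>

definition of_bidual :: "'a::real_tvs dual dual \<Rightarrow> 'a" where
  "of_bidual \<Phi> = (THE x. to_bidual x = \<Phi>)"


section \<open>Smoothness in the sense of Gateaux\<close>

definition has_gateaux_deriv :: "('a::real_tvs \<Rightarrow> 'b::real_tvs) \<Rightarrow> 'a \<Rightarrow> 'a \<Rightarrow> 'b \<Rightarrow> bool" where
  "has_gateaux_deriv f x h l \<longleftrightarrow> ((\<lambda>t::real. (1 / t) *\<^sub>R (f (x + t *\<^sub>R h) - f x)) \<longlongrightarrow> l) (at 0)"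

definition gateaux_deriv :: "('a::real_tvs \<Rightarrow> 'b::real_tvs) \<Rightarrow> 'a \<Rightarrow> 'a \<Rightarrow> 'b" where
  "gateaux_deriv f x h = Lim (at 0) (\<lambda>t::real. (1 / t) *\<^sub>R (f (x + t *\<^sub>R h) - f x))"

text \<open>Iterated directional derivatives; the head of the list is the direction of the last
  differentiation.\<close>

primrec iter_deriv :: "('a::real_tvs \<Rightarrow> 'b::real_tvs) \<Rightarrow> 'a list \<Rightarrow> 'a \<Rightarrow> 'b" where
  "iter_deriv f [] x = f x"
| "iter_deriv f (h # hs) x = gateaux_deriv (iter_deriv f hs) x h"

text \<open>All iterated directional derivatives \<open>d\<^sup>n f : X \<times> X\<^sup>n \<rightarrow> Y\<close> exist and are jointly
  continuous. The directions are presented as the first \<open>n\<close> entries of a sequence \<open>h\<close>, where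
  the space of sequences carries the product topology: a function of \<open>(x, h)\<close> depending only
  on \<open>x\<close> and the first \<open>n\<close> entries of \<open>h\<close> is continuous iff it is continuous on \<open>X \<times> X\<^sup>n\<close>.\<close>

definition gateaux_smooth :: "('a::real_tvs \<Rightarrow> 'b::real_tvs) \<Rightarrow> bool" where
  "gateaux_smooth f \<longleftrightarrow>
     (\<forall>hs x h. \<exists>l. has_gateaux_deriv (iter_deriv f hs) x h l) \<and>
     (\<forall>n. continuous_on UNIV (\<lambda>(x, h :: nat \<Rightarrow> 'a). iter_deriv f (map h [0..<n]) x))"

text \<open>The derivative \<open>dF[\<gamma>]\<close> of a smooth functional on a dual space is an element of the bidual.\<close>

definition gateaux_differential :: "('a::real_tvs dual \<Rightarrow> real) \<Rightarrow> 'a dual \<Rightarrow> 'a dual dual" where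
  "gateaux_differential F \<gamma> = Abs_dual (gateaux_deriv F \<gamma>)"

lemma gateaux_deriv_eq:
  "has_gateaux_deriv f x h l \<Longrightarrow> gateaux_deriv f x h = l"
  unfolding has_gateaux_deriv_def gateaux_deriv_def by (intro tendsto_Lim) auto

lemma gateaux_smooth_has_deriv:
  assumes "gateaux_smooth f"
  shows "has_gateaux_deriv (iter_deriv f hs) x h (gateaux_deriv (iter_deriv f hs) x h)"
proof -
  from conjunct1[OF assms[unfolded gateaux_smooth_def]]
  obtain l where l: "has_gateaux_deriv (iter_deriv f hs) x h l" by fast
  then show ?thesis by (simp only: gateaux_deriv_eq[OF l])
qed

lemma gateaux_smooth_continuous_n:
  "gateaux_smooth f \<Longrightarrow> continuous_on UNIV (\<lambda>(x, h :: nat \<Rightarrow> 'a::real_tvs). iter_deriv f (map h [0..<n]) x)"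
  unfolding gateaux_smooth_def by (elim conjE) (rule spec)

lemma gateaux_smooth_continuous_map:
  fixes f :: "'a::real_tvs \<Rightarrow> 'b::real_tvs"
  assumes "gateaux_smooth f"
  shows "continuous_on UNIV (\<lambda>p :: 'a \<times> (nat \<Rightarrow> 'a). iter_deriv f (map (snd p) xs @ es) (fst p))"
proof -
  let ?r = "\<lambda>p :: 'a \<times> (nat \<Rightarrow> 'a).
    (fst p, \<lambda>k. if k < length xs then snd p (xs ! k) else es ! (k - length xs))"
  have eq: "map (snd p) xs @ es = map (snd (?r p)) [0..<length xs + length es]" for p
    by (rule nth_equalityI) (auto simp: nth_append)
  have "continuous_on UNIV (\<lambda>p :: 'a \<times> (nat \<Rightarrow> 'a).
      if k < length xs then snd p (xs ! k) else es ! (k - length xs))" for k :: nat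
  proof (cases "k < length xs")
    case True
    have "continuous_on UNIV (\<lambda>p :: 'a \<times> (nat \<Rightarrow> 'a). snd p (xs ! k))"
      by (rule continuous_on_compose2[of UNIV "\<lambda>h. h (xs ! k)" UNIV snd])
         (auto intro: continuous_on_product_coordinates continuous_on_snd continuous_on_id)
    then show ?thesis using True by simp
  qed simp
  then have r: "continuous_on UNIV ?r"
    by (intro continuous_on_Pair continuous_on_fst continuous_on_id
        continuous_on_coordinatewise_then_product)
  have "continuous_on UNIV (\<lambda>p. (\<lambda>(x, h). iter_deriv f (map h [0..<length xs + length es]) x) (?r p))"
    by (rule continuous_on_compose2[OF gateaux_smooth_continuous_n[OF assms] r subset_UNIV])
  then show ?thesis unfolding eq by simp
qed

lemma gateaux_smooth_continuous:
  assumes "gateaux_smooth f"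
  shows "continuous_on UNIV (\<lambda>x. iter_deriv f es x)"
proof -
  have "continuous_on UNIV (\<lambda>x. (x, \<lambda>_ :: nat. x))"
    by (intro continuous_on_Pair continuous_on_id continuous_on_coordinatewise_then_product)
  from continuous_on_compose2[OF gateaux_smooth_continuous_map[OF assms, of "[]" es] this subset_UNIV]
  show ?thesis by simp
qed

lemma gateaux_smoothI:
  fixes f :: "'a::real_tvs \<Rightarrow> 'b::real_tvs"
  assumes "\<And>x. D [] x = f x"
    and "\<And>hs x h. has_gateaux_deriv (D hs) x h (D (h # hs) x)"
    and "\<And>n. continuous_on UNIV (\<lambda>p :: 'a \<times> (nat \<Rightarrow> 'a). D (map (snd p) [0..<n]) (fst p))"
  shows "gateaux_smooth f" and "iter_deriv f hs x = D hs x"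
proof -
  have D: "iter_deriv f hs = D hs" for hs
  proof (induction hs)
    case Nil show ?case by (rule ext) (simp add: assms(1))
  next
    case (Cons h hs) show ?case
      by (rule ext) (simp only: iter_deriv.simps(2) Cons gateaux_deriv_eq[OF assms(2)])
  qed
  then show "iter_deriv f hs x = D hs x" by simp
  show "gateaux_smooth f"
    unfolding gateaux_smooth_def D case_prod_unfold
    by (intro conjI allI exI, rule assms(2), rule assms(3))
qed

lemma gateaux_smooth_iter_deriv:
  assumes "gateaux_smooth f" shows "gateaux_smooth (iter_deriv f es)"
proof (rule gateaux_smoothI(1)[where D = "\<lambda>hs. iter_deriv f (hs @ es)"])
  show "has_gateaux_deriv (iter_deriv f (hs @ es)) x h (iter_deriv f ((h # hs) @ es) x)" for hs x h
    using gateaux_smooth_has_deriv[OF assms] by simp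
qed (use gateaux_smooth_continuous_map[OF assms] in simp_all)

lemma gateaux_smooth_deriv:
  assumes "gateaux_smooth f" shows "gateaux_smooth (\<lambda>x. gateaux_deriv f x h)"
proof -
  have "iter_deriv f [] = f" by (rule ext) simp
  then have "iter_deriv f [h] = (\<lambda>x. gateaux_deriv f x h)"
    by (intro ext) (simp only: iter_deriv.simps(2))
  then show ?thesis using gateaux_smooth_iter_deriv[OF assms, of "[h]"] by (simp only:)
qed

lemma gateaux_smooth_zero: "gateaux_smooth (\<lambda>_. 0)"
  by (rule gateaux_smoothI(1)[where D = "\<lambda>_ _. 0"]) (auto simp: has_gateaux_deriv_def)

lemma has_gateaux_deriv_add:
  fixes f g :: "'a::real_tvs \<Rightarrow> real"
  assumes "has_gateaux_deriv f x h l" "has_gateaux_deriv g x h m"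
  shows "has_gateaux_deriv (\<lambda>x. f x + g x) x h (l + m)"
  using tendsto_add[OF assms[unfolded has_gateaux_deriv_def]]
  by (simp add: has_gateaux_deriv_def algebra_simps diff_divide_distrib add_divide_distrib)

text \<open>The Leibniz rule: sum over all distributions of the directions among the two factors.\<close>

primrec list_splits :: "'b list \<Rightarrow> ('b list \<times> 'b list) list" where
  "list_splits [] = [([], [])]"
| "list_splits (h # hs) =
     map (\<lambda>(as, bs). (h # as, bs)) (list_splits hs) @ map (\<lambda>(as, bs). (as, h # bs)) (list_splits hs)"

lemma list_splits_map:
  "list_splits (map k xs) = map (\<lambda>(as, bs). (map k as, map k bs)) (list_splits xs)"
  by (induction xs) (auto simp: case_prod_unfold)

lemma sum_list_pair_add:
  fixes P Q :: "'b \<Rightarrow> 'c \<Rightarrow> real"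
  shows "(\<Sum>(as, bs)\<leftarrow>L. P as bs + Q as bs) = (\<Sum>(as, bs)\<leftarrow>L. P as bs) + (\<Sum>(as, bs)\<leftarrow>L. Q as bs)"
  by (induction L) auto

context
  fixes f g :: "'a::real_tvs \<Rightarrow> real"
  assumes f: "gateaux_smooth f" and g: "gateaux_smooth g"
begin

lemma continuous_pieces:
  "continuous_on UNIV (\<lambda>p :: 'a \<times> (nat \<Rightarrow> 'a). iter_deriv f (map (snd p) xs) (fst p))"
  "continuous_on UNIV (\<lambda>p :: 'a \<times> (nat \<Rightarrow> 'a). iter_deriv g (map (snd p) xs) (fst p))"
  using gateaux_smooth_continuous_map[OF f, of xs "[]"] gateaux_smooth_continuous_map[OF g, of xs "[]"]
  by simp_all

lemma gateaux_smooth_add: "gateaux_smooth (\<lambda>x. f x + g x)"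
  and iter_deriv_add: "iter_deriv (\<lambda>x. f x + g x) hs x = iter_deriv f hs x + iter_deriv g hs x"
proof -
  let ?D = "\<lambda>hs x. iter_deriv f hs x + iter_deriv g hs x"
  have d: "has_gateaux_deriv (?D hs) x h (?D (h # hs) x)" for hs x h
    using has_gateaux_deriv_add[OF gateaux_smooth_has_deriv[OF f] gateaux_smooth_has_deriv[OF g]]
    by simp
  note * = gateaux_smoothI[where D = ?D, OF _ d]
  show "gateaux_smooth (\<lambda>x. f x + g x)"
    by (rule *) (auto intro!: continuous_on_add continuous_pieces)
  show "iter_deriv (\<lambda>x. f x + g x) hs x = iter_deriv f hs x + iter_deriv g hs x"
    by (rule *) (auto intro!: continuous_on_add continuous_pieces)
qed

lemma gateaux_smooth_scale: "gateaux_smooth (\<lambda>x. c * f x)"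
  and iter_deriv_scale: "iter_deriv (\<lambda>x. c * f x) hs x = c * iter_deriv f hs x"
proof -
  let ?D = "\<lambda>hs x. c * iter_deriv f hs x"
  have d: "has_gateaux_deriv (?D hs) x h (?D (h # hs) x)" for hs x h
    using tendsto_mult_left[OF gateaux_smooth_has_deriv[OF f, of hs x h, unfolded has_gateaux_deriv_def], of c]
    by (simp add: has_gateaux_deriv_def algebra_simps)
  note * = gateaux_smoothI[where D = ?D, OF _ d]
  show "gateaux_smooth (\<lambda>x. c * f x)"
    by (rule *) (auto intro!: continuous_on_mult_left continuous_pieces)
  show "iter_deriv (\<lambda>x. c * f x) hs x = c * iter_deriv f hs x"
    by (rule *) (auto intro!: continuous_on_mult_left continuous_pieces)
qed

lemma has_gateaux_deriv_mult:
  "has_gateaux_deriv (\<lambda>x. iter_deriv f as x * iter_deriv g bs x) x h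
     (iter_deriv f (h # as) x * iter_deriv g bs x + iter_deriv f as x * iter_deriv g (h # bs) x)"
proof -
  have lf: "((\<lambda>t. (1 / t) * (iter_deriv f as (x + t *\<^sub>R h) - iter_deriv f as x))
      \<longlongrightarrow> iter_deriv f (h # as) x) (at 0)"
    and lg: "((\<lambda>t. (1 / t) * (iter_deriv g bs (x + t *\<^sub>R h) - iter_deriv g bs x))
      \<longlongrightarrow> iter_deriv g (h # bs) x) (at 0)"
    using gateaux_smooth_has_deriv[OF f, of as x h] gateaux_smooth_has_deriv[OF g, of bs x h]
    by (simp_all add: has_gateaux_deriv_def)
  have "((\<lambda>t::real. x + t *\<^sub>R h) \<longlongrightarrow> x + 0 *\<^sub>R h) (at 0)"
    by (intro tendsto_add tendsto_scaleR_tvs tendsto_const tendsto_ident_at)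
  then have "((\<lambda>t. iter_deriv g bs (x + t *\<^sub>R h)) \<longlongrightarrow> iter_deriv g bs x) (at 0)"
    using continuous_on_tendsto_compose[OF gateaux_smooth_continuous[OF g, of bs], of "\<lambda>t. x + t *\<^sub>R h" x "at 0"]
    by simp
  from tendsto_add[OF tendsto_mult[OF lf this] tendsto_mult[OF tendsto_const[of "iter_deriv f as x"] lg]]
  show ?thesis
    unfolding has_gateaux_deriv_def
    by (rule Lim_transform_eventually) (auto simp: algebra_simps intro!: always_eventually)
qed

lemma gateaux_smooth_mult: "gateaux_smooth (\<lambda>x. f x * g x)"
proof (rule gateaux_smoothI(1)
    [where D = "\<lambda>hs x. \<Sum>(as, bs)\<leftarrow>list_splits hs. iter_deriv f as x * iter_deriv g bs x"])
  fix hs :: "'a list" and x h :: 'a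
  have "has_gateaux_deriv (\<lambda>x. \<Sum>(as, bs)\<leftarrow>L. iter_deriv f as x * iter_deriv g bs x) x h
     (\<Sum>(as, bs)\<leftarrow>L. iter_deriv f (h # as) x * iter_deriv g bs x + iter_deriv f as x * iter_deriv g (h # bs) x)"
    for L
  proof (induction L)
    case (Cons ab L)
    show ?case
      using has_gateaux_deriv_add[OF has_gateaux_deriv_mult[of "fst ab" "snd ab" x h] Cons]
      by (simp add: case_prod_unfold)
  qed (simp add: has_gateaux_deriv_def)
  moreover have "(\<Sum>(as, bs)\<leftarrow>list_splits (h # hs). iter_deriv f as x * iter_deriv g bs x) =
     (\<Sum>(as, bs)\<leftarrow>list_splits hs. iter_deriv f (h # as) x * iter_deriv g bs x) +
     (\<Sum>(as, bs)\<leftarrow>list_splits hs. iter_deriv f as x * iter_deriv g (h # bs) x)"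
    by (simp add: o_def case_prod_unfold)
  ultimately show "has_gateaux_deriv (\<lambda>x. \<Sum>(as, bs)\<leftarrow>list_splits hs. iter_deriv f as x * iter_deriv g bs x) x h
     (\<Sum>(as, bs)\<leftarrow>list_splits (h # hs). iter_deriv f as x * iter_deriv g bs x)"
    by (simp only: sum_list_pair_add)
next
  fix n
  have "continuous_on UNIV (\<lambda>p. \<Sum>(as, bs)\<leftarrow>L.
      iter_deriv f (map (snd p) as) (fst p) * iter_deriv g (map (snd p) bs) (fst p))"
    for L :: "(nat list \<times> nat list) list"
    by (induction L) (auto simp: case_prod_unfold intro!: continuous_intros continuous_pieces)
  then show "continuous_on UNIV (\<lambda>p. \<Sum>(as, bs)\<leftarrow>list_splits (map (snd p) [0..<n]).
      iter_deriv f as (fst p) * iter_deriv g bs (fst p))"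
    by (simp add: list_splits_map o_def case_prod_unfold)
qed simp

end

lemma gateaux_smooth_sum:
  fixes f :: "'i \<Rightarrow> 'a::real_tvs \<Rightarrow> real"
  assumes "\<And>i. i \<in> A \<Longrightarrow> gateaux_smooth (f i)"
  shows "gateaux_smooth (\<lambda>x. \<Sum>i\<in>A. f i x)"
  using assms
  by (induction A rule: infinite_finite_induct) (simp_all add: gateaux_smooth_zero gateaux_smooth_add)

lemma gateaux_smooth_diff:
  fixes f g :: "'a::real_tvs \<Rightarrow> real"
  assumes "gateaux_smooth f" "gateaux_smooth g"
  shows "gateaux_smooth (\<lambda>x. f x - g x)"
  using gateaux_smooth_add[OF assms(1) gateaux_smooth_scale[OF assms(2) assms(2), of "-1"]] by simp


section \<open>The Poisson bracket on the N-particle phase space\<close>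

text \<open>Points \<open>z = (x, v)\<close> of \<open>\<real>\<^sup>2\<^sup>d\<close> with \<open>d = CARD('d)\<close>, and configurations of \<open>N = CARD('n)\<close> of them.\<close>

type_synonym 'd phase = "(real ^ 'd) \<times> (real ^ 'd)"
type_synonym ('d, 'n) config = "((real ^ 'd) \<times> (real ^ 'd)) ^ 'n"

definition grad_x :: "'n \<Rightarrow> (('d::finite, 'n::finite) config \<Rightarrow> real) \<Rightarrow> ('d, 'n) config \<Rightarrow> real ^ 'd" where
  "grad_x i F z = (\<chi> j. gateaux_deriv F z (axis i (axis j 1, 0)))"

definition grad_v :: "'n \<Rightarrow> (('d::finite, 'n::finite) config \<Rightarrow> real) \<Rightarrow> ('d, 'n) config \<Rightarrow> real ^ 'd" where
  "grad_v i F z = (\<chi> j. gateaux_deriv F z (axis i (0, axis j 1)))"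

definition poisson_bracket ::
  "(('d::finite, 'n::finite) config \<Rightarrow> real) \<Rightarrow> (('d, 'n) config \<Rightarrow> real) \<Rightarrow> ('d, 'n) config \<Rightarrow> real" where
  "poisson_bracket F G z =
     real CARD('n) * (\<Sum>i\<in>UNIV. grad_x i F z \<bullet> grad_v i G z - grad_v i F z \<bullet> grad_x i G z)"


section \<open>The Lie algebra of symmetric smooth functions\<close>

definition permute_config :: "('n \<Rightarrow> 'n) \<Rightarrow> ('d, 'n::finite) config \<Rightarrow> ('d, 'n) config" where
  "permute_config \<pi> z = (\<chi> i. z $ \<pi> i)"

typedef ('d::finite, 'n::finite) sym_smooth =
  "{f :: ('d, 'n) config \<Rightarrow> real.
      gateaux_smooth f \<and> (\<forall>\<pi> z. \<pi> permutes UNIV \<longrightarrow> f (permute_config \<pi> z) = f z)}"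
  morphisms apply_sym Abs_sym
  by (rule exI[of _ "\<lambda>_. 0"]) (simp add: gateaux_smooth_zero)

setup_lifting type_definition_sym_smooth

lemma sym_smooth_eqI: "(\<And>z. apply_sym f z = apply_sym g z) \<Longrightarrow> f = g"
  by (rule apply_sym_inject[THEN iffD1]) (rule ext)

instantiation sym_smooth :: (finite, finite) real_vector
begin

lift_definition zero_sym_smooth :: "('a, 'b) sym_smooth" is "\<lambda>_. 0"
  by (simp add: gateaux_smooth_zero)
lift_definition plus_sym_smooth :: "('a, 'b) sym_smooth \<Rightarrow> ('a, 'b) sym_smooth \<Rightarrow> ('a, 'b) sym_smooth"
  is "\<lambda>f g z. f z + g z" by (simp add: gateaux_smooth_add)
lift_definition minus_sym_smooth :: "('a, 'b) sym_smooth \<Rightarrow> ('a, 'b) sym_smooth \<Rightarrow> ('a, 'b) sym_smooth"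
  is "\<lambda>f g z. f z - g z" by (simp add: gateaux_smooth_diff)
lift_definition uminus_sym_smooth :: "('a, 'b) sym_smooth \<Rightarrow> ('a, 'b) sym_smooth"
  is "\<lambda>f z. - f z" using gateaux_smooth_scale[of _ _ "-1"] by auto
lift_definition scaleR_sym_smooth :: "real \<Rightarrow> ('a, 'b) sym_smooth \<Rightarrow> ('a, 'b) sym_smooth"
  is "\<lambda>c f z. c * f z" using gateaux_smooth_scale by auto

instance
  by intro_classes
    (simp_all add: sym_smooth_eqI zero_sym_smooth.rep_eq plus_sym_smooth.rep_eq
      minus_sym_smooth.rep_eq uminus_sym_smooth.rep_eq scaleR_sym_smooth.rep_eq algebra_simps)

end

text \<open>The supremum over \<open>K\<close> of all partial derivatives of order at most \<open>n\<close>. A partial derivative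
  is given by the list of coordinate directions of the successive differentiations instead of a
  multi-index; by symmetry of the iterated derivatives both range over the same functions.\<close>

definition sym_seminorm :: "nat \<Rightarrow> ('d::finite, 'n::finite) config set \<Rightarrow> ('d, 'n) sym_smooth \<Rightarrow> real" where
  "sym_seminorm n K f =
     (SUP (es, z) \<in> {es. set es \<subseteq> Basis \<and> length es \<le> n} \<times> K. \<bar>iter_deriv (apply_sym f) es z\<bar>)"

instantiation sym_smooth :: (finite, finite) topological_space
begin

definition open_sym_smooth :: "('a, 'b) sym_smooth set \<Rightarrow> bool" where
  "open_sym_smooth =
     seminorm_open (UNIV \<times> {K. compact K \<and> K \<noteq> {}}) (\<lambda>(n, K). sym_seminorm n K)"

instance
  by standard
    (auto simp: open_sym_smooth_def intro: seminorm_open_UNIV seminorm_open_Int seminorm_open_Union)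

end

lemma apply_sym_smooth: "gateaux_smooth (apply_sym f)"
  and apply_sym_permute: "\<pi> permutes UNIV \<Longrightarrow> apply_sym f (permute_config \<pi> z) = apply_sym f z"
  using apply_sym[of f] by auto

lemma sym_seminorm_bdd_above:
  assumes "compact K"
  shows "bdd_above ((\<lambda>(es, z). \<bar>iter_deriv (apply_sym f) es z\<bar>) `
           ({es. set es \<subseteq> Basis \<and> length es \<le> n} \<times> K))"
proof -
  let ?E = "{es :: ('a, 'b) config list. set es \<subseteq> Basis \<and> length es \<le> n}"
  have fin: "finite ?E" by (rule finite_lists_length_le) simp
  have "bdd_above ((\<lambda>z. \<bar>iter_deriv (apply_sym f) es z\<bar>) ` K)" for es
  proof -
    have "compact ((\<lambda>z. \<bar>iter_deriv (apply_sym f) es z\<bar>) ` K)"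
      by (intro compact_continuous_image assms continuous_on_rabs
          continuous_on_subset[OF gateaux_smooth_continuous[OF apply_sym_smooth] subset_UNIV])
    then show ?thesis by (intro bounded_imp_bdd_above compact_imp_bounded)
  qed
  then have "bdd_above (\<Union>es\<in>?E. (\<lambda>z. \<bar>iter_deriv (apply_sym f) es z\<bar>) ` K)"
    using fin by simp
  moreover have "(\<lambda>(es, z). \<bar>iter_deriv (apply_sym f) es z\<bar>) ` (?E \<times> K) =
      (\<Union>es\<in>?E. (\<lambda>z. \<bar>iter_deriv (apply_sym f) es z\<bar>) ` K)"
    by auto
  ultimately show ?thesis by simp
qed

lemma sym_seminorm_is_seminorm:
  assumes "compact K" "K \<noteq> {}"
  shows "is_seminorm (sym_seminorm n K)"
proof -
  have "{es. set es \<subseteq> Basis \<and> length es \<le> n} \<times> K \<noteq> {}" using assms(2) by (auto intro: exI[of _ "[]"])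
  then show ?thesis
    unfolding sym_seminorm_def[abs_def] case_prod_unfold
    by (rule SUP_abs_is_seminorm)
       (auto simp: plus_sym_smooth.rep_eq scaleR_sym_smooth.rep_eq
          iter_deriv_add[OF apply_sym_smooth apply_sym_smooth]
          iter_deriv_scale[OF apply_sym_smooth apply_sym_smooth]
        intro!: sym_seminorm_bdd_above[OF assms(1), unfolded case_prod_unfold])
qed

lemma abs_apply_sym_le_seminorm:
  assumes "compact K" "z \<in> K"
  shows "\<bar>apply_sym f z\<bar> \<le> sym_seminorm n K f"
proof -
  have "(\<lambda>(es, z). \<bar>iter_deriv (apply_sym f) es z\<bar>) ([], z) \<le> sym_seminorm n K f"
    unfolding sym_seminorm_def using assms by (intro cSUP_upper sym_seminorm_bdd_above) auto
  then show ?thesis by simp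
qed

instance sym_smooth :: (finite, finite) real_tvs
proof (rule OFCLASS_real_tvs_seminorms)
  let ?I = "UNIV \<times> {K. compact K \<and> K \<noteq> {}} :: (nat \<times> ('a, 'b) config set) set"
  show "open U \<longleftrightarrow> seminorm_open ?I (\<lambda>(n, K). sym_seminorm n K) U" for U :: "('a, 'b) sym_smooth set"
    by (simp add: open_sym_smooth_def)
  show "is_seminorm ((\<lambda>(n, K). sym_seminorm n K) i)" if "i \<in> ?I" for i
    using that by (auto intro: sym_seminorm_is_seminorm)
  show "\<exists>i\<in>?I. (\<lambda>(n, K). sym_seminorm n K) i f \<noteq> 0" if "f \<noteq> 0" for f :: "('a, 'b) sym_smooth"
  proof -
    obtain z where "apply_sym f z \<noteq> 0"
      using \<open>f \<noteq> 0\<close> apply_sym_inject[of f 0] by (auto simp: fun_eq_iff zero_sym_smooth.rep_eq)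
    then have "sym_seminorm 0 {z} f \<noteq> 0"
      using abs_apply_sym_le_seminorm[of "{z}" z f 0] by auto
    then show ?thesis by (intro bexI[of _ "(0, {z})"]) auto
  qed
qed

lemma tendsto_sym_smooth_iff:
  fixes f :: "'c \<Rightarrow> ('a::finite, 'b::finite) sym_smooth"
  shows "(f \<longlongrightarrow> l) F \<longleftrightarrow> (\<forall>i\<in>UNIV \<times> {K. compact K \<and> K \<noteq> {}}.
    ((\<lambda>x. (\<lambda>(n, K). sym_seminorm n K) i (f x - l)) \<longlongrightarrow> 0) F)"
proof (rule tendsto_seminorm_iff)
  show "open U \<longleftrightarrow> seminorm_open (UNIV \<times> {K. compact K \<and> K \<noteq> {}}) (\<lambda>(n, K). sym_seminorm n K) U"
    for U :: "('a, 'b) sym_smooth set"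
    by (simp add: open_sym_smooth_def)
  show "is_seminorm ((\<lambda>(n, K). sym_seminorm n K) i)" if "i \<in> UNIV \<times> {K. compact K \<and> K \<noteq> {}}"
    for i :: "nat \<times> ('a, 'b) config set"
    using that by (auto intro: sym_seminorm_is_seminorm)
qed

text \<open>The bracket \<open>{f, g}\<^sub>N\<close> as an operation on symmetric smooth functions.\<close>

lemma permute_config_axis:
  assumes "\<pi> permutes (UNIV :: 'n::finite set)"
  shows "permute_config \<pi> (axis (\<pi> i) e :: ('d::finite, 'n) config) = axis i e"
  using permutes_inj[OF assms] by (auto simp: permute_config_def axis_def vec_eq_iff inj_eq)

lemma gateaux_deriv_permute:
  fixes f :: "('d::finite, 'n::finite) config \<Rightarrow> real"
  assumes "\<And>z. f (permute_config \<pi> z) = f z" "\<pi> permutes UNIV"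
  shows "gateaux_deriv f (permute_config \<pi> z) (axis i e) = gateaux_deriv f z (axis (\<pi> i) e)"
proof -
  have "permute_config \<pi> z + t *\<^sub>R axis i e = permute_config \<pi> (z + t *\<^sub>R axis (\<pi> i) e)" for t
    unfolding permute_config_axis[OF assms(2), of i e, symmetric]
    by (simp add: permute_config_def vec_eq_iff)
  then show ?thesis by (simp add: gateaux_deriv_def assms(1))
qed

lemma poisson_bracket_smooth:
  assumes "gateaux_smooth F" "gateaux_smooth G"
  shows "gateaux_smooth (poisson_bracket F G)"
proof -
  have c: "gateaux_smooth (\<lambda>x. c * f x)" if "gateaux_smooth f" for c and f :: "'z::real_tvs \<Rightarrow> real"
    using gateaux_smooth_scale[OF that that] .
  show ?thesis
    unfolding poisson_bracket_def[abs_def] inner_vec_def grad_x_def grad_v_def vec_lambda_beta inner_real_def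
    by (intro c gateaux_smooth_sum gateaux_smooth_diff gateaux_smooth_mult gateaux_smooth_deriv assms)
qed

lemma poisson_bracket_permute:
  fixes F G :: "('d::finite, 'n::finite) config \<Rightarrow> real"
  assumes "\<And>z. F (permute_config \<pi> z) = F z" "\<And>z. G (permute_config \<pi> z) = G z" "\<pi> permutes UNIV"
  shows "poisson_bracket F G (permute_config \<pi> z) = poisson_bracket F G z"
proof -
  have "grad_x i H (permute_config \<pi> z) = grad_x (\<pi> i) H z"
    "grad_v i H (permute_config \<pi> z) = grad_v (\<pi> i) H z"
    if "\<And>z. H (permute_config \<pi> z) = H z" for i H
    using gateaux_deriv_permute[of H \<pi>, OF that assms(3)] by (simp_all add: grad_x_def grad_v_def)
  note * = this[where H = F, OF assms(1)] this[where H = G, OF assms(2)]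
  show ?thesis
    unfolding poisson_bracket_def *
    using sum.permute[OF assms(3), of "\<lambda>i. grad_x i F z \<bullet> grad_v i G z - grad_v i F z \<bullet> grad_x i G z"]
    by (simp add: o_def)
qed

lift_definition lie_bracket ::
  "('d::finite, 'n::finite) sym_smooth \<Rightarrow> ('d, 'n) sym_smooth \<Rightarrow> ('d, 'n) sym_smooth" is poisson_bracket
  by (simp add: poisson_bracket_smooth poisson_bracket_permute)

definition lie_poisson_bracket ::
  "(('d::finite, 'n::finite) sym_smooth dual \<Rightarrow> real) \<Rightarrow> (('d, 'n) sym_smooth dual \<Rightarrow> real)
    \<Rightarrow> ('d, 'n) sym_smooth dual \<Rightarrow> real" where
  "lie_poisson_bracket F G \<gamma> =
     pairing \<gamma> (lie_bracket (of_bidual (gateaux_differential F \<gamma>)) (of_bidual (gateaux_differential G \<gamma>)))"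


section \<open>Symmetrised Dirac masses\<close>

text \<open>\<open>\<delta>\<^bsub>z1\<^esub> \<otimes> \<dots> \<otimes> \<delta>\<^bsub>zN\<^esub>\<close> is the Dirac mass at the configuration \<open>(z1, \<dots>, zN)\<close>, here as a
  functional on symmetric functions.\<close>

lemma apply_sym_continuous: "continuous_on UNIV (\<lambda>f. apply_sym f z)"
  unfolding continuous_on_def
proof
  fix f :: "('a, 'b) sym_smooth"
  have "((\<lambda>g. g) \<longlongrightarrow> f) (at f within UNIV)" by (rule tendsto_ident_at)
  then have "((\<lambda>g. sym_seminorm 0 {z} (g - f)) \<longlongrightarrow> 0) (at f within UNIV)"
    unfolding tendsto_sym_smooth_iff by (drule_tac bspec[of _ _ "(0, {z})"]) auto
  then have "((\<lambda>g. apply_sym (g - f) z) \<longlongrightarrow> 0) (at f within UNIV)"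
    by (rule Lim_null_comparison[rotated]) (simp add: abs_apply_sym_le_seminorm)
  then show "((\<lambda>g. apply_sym g z) \<longlongrightarrow> apply_sym f z) (at f within UNIV)"
    by (simp add: minus_sym_smooth.rep_eq LIM_zero_cancel)
qed

lift_definition dirac_tensor :: "('d::finite, 'n::finite) config \<Rightarrow> ('d, 'n) sym_smooth dual"
  is "\<lambda>z f. apply_sym f z"
  by (auto intro!: linearI apply_sym_continuous simp: plus_sym_smooth.rep_eq scaleR_sym_smooth.rep_eq)

definition iota_Lio :: "('d::finite, 'n::finite) config \<Rightarrow> ('d, 'n) sym_smooth dual" where
  "iota_Lio z = (1 / fact CARD('n)) *\<^sub>R (\<Sum>\<pi> | \<pi> permutes UNIV. dirac_tensor (permute_config \<pi> z))"

end

theory Submission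
  imports Defs
begin

text \<open>On symmetric functions \<open>\<iota>(z)\<close> is the Dirac mass at \<open>z\<close>, whose derivatives are
  \<open>f \<mapsto> D\<^sup>n f(z)(h\<^sub>1, \<dots>, h\<^sub>n)\<close>; by Taylor's formula the difference quotients converge uniformly on
  bounded sets of \<open>f\<close>, so \<open>\<iota>\<close> is smooth. The chain rule gives
  \<open>d(F \<circ> \<iota>)(z)(h) = dF[\<iota>(z)](D\<^sub>h \<delta>\<^sub>z)\<close>, which equals \<open>Df(z)(h)\<close> if \<open>dF[\<iota>(z)]\<close> is represented by a
  symmetric smooth function \<open>f\<close>, and the brackets agree.

  Such an \<open>f\<close> exists by semireflexivity: a functional \<open>\<Phi>\<close> in the bidual is dominated by the supremum
  over some bounded set, so by finite-dimensional separation it can be approximated, on any finite set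
  of distributions, by elements of that set. Taking one arbitrary distribution \<open>\<gamma>\<close> together with the
  Dirac masses at a fine finite net, and using that bounded sequences converging pointwise also
  converge with all derivatives, \<open>\<Phi>(\<gamma>) = \<gamma>(g)\<close> for \<open>g(z) = \<Phi>(\<delta>\<^sub>z)\<close>.\<close>

section \<open>Gateaux derivatives of real-valued smooth functions\<close>

lemma gateaux_smooth_has_gateaux_deriv:
  assumes "gateaux_smooth f"
  shows "has_gateaux_deriv f x h (gateaux_deriv f x h)"
proof -
  have "iter_deriv f [] = f" by (rule ext) simp
  then show ?thesis using gateaux_smooth_has_deriv[OF assms, of "[]" x h] by simp
qed

lemma has_real_derivative_line:
  fixes f :: "'a::real_tvs \<Rightarrow> real"
  assumes "gateaux_smooth f"
  shows "((\<lambda>t. f (x + t *\<^sub>R h)) has_real_derivative gateaux_deriv f (x + t *\<^sub>R h) h) (at t)"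
  using gateaux_smooth_has_gateaux_deriv[OF assms, of "x + t *\<^sub>R h" h]
  by (simp add: has_gateaux_deriv_def DERIV_def scaleR_add_left add.assoc)

text \<open>The classical mean value theorem for
  \<open>s \<mapsto> f (x + (s * t) *\<^sub>R h)\<close> on the unit interval. With \<open>t\<close>
  as an outer factor, steps of either sign and the zero step need no separate treatment.\<close>

lemma mvt_line:
  fixes f :: "'a::real_tvs \<Rightarrow> real"
  assumes "gateaux_smooth f"
  shows "\<exists>s\<in>{0..1}. f (x + t *\<^sub>R h) - f x = t * gateaux_deriv f (x + (s * t) *\<^sub>R h) h"
proof -
  have "((\<lambda>s. f (x + (s * t) *\<^sub>R h)) has_real_derivative t * gateaux_deriv f (x + (s * t) *\<^sub>R h) h) (at s)" for s
    using DERIV_chain2[where f = "\<lambda>t. f (x + t *\<^sub>R h)" and g = "\<lambda>s. s * t" and x = s,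
        OF has_real_derivative_line[OF assms] DERIV_cmult_right[OF DERIV_ident]]
    by (simp add: mult.commute)
  from MVT2[of 0 1 "\<lambda>s. f (x + (s * t) *\<^sub>R h)", OF _ this]
  obtain s where "0 < s" "s < 1" "f (x + t *\<^sub>R h) - f x = t * gateaux_deriv f (x + (s * t) *\<^sub>R h) h"
    by auto
  then show ?thesis by (intro bexI[of _ s]) auto
qed

lemma gateaux_deriv_continuous:
  assumes "gateaux_smooth f"
  shows "continuous_on UNIV (\<lambda>p. gateaux_deriv f (fst p) (snd p))"
proof -
  have "iter_deriv f [] = f" by (rule ext) simp
  \<comment> \<open>A single direction enters the sequence form of joint continuity as a constant
    sequence, of which only the first entry is read.\<close>
  moreover have "continuous_on UNIV (\<lambda>p. (fst p, \<lambda>_ :: nat. snd p))"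
    by (intro continuous_on_Pair continuous_on_fst continuous_on_snd continuous_on_id
        continuous_on_coordinatewise_then_product)
  from continuous_on_compose2[OF gateaux_smooth_continuous_n[OF assms, of 1] this]
  have "continuous_on UNIV (\<lambda>p. gateaux_deriv (iter_deriv f []) (fst p) (snd p))"
    by simp
  ultimately show ?thesis by simp
qed

text \<open>By the mean value theorem the quotient is a derivative of \<open>f\<close> at a point
  tending to \<open>x\<close> in a direction tending to \<open>h\<close>, and the derivative is
  jointly continuous. The moving base point serves additivity of the derivative, the moving
  direction serves the chain rule.\<close>

lemma tendsto_difference_quotient:
  fixes f :: "'a::real_tvs \<Rightarrow> real"
  assumes f: "gateaux_smooth f"
    and u: "(u \<longlongrightarrow> x) F" and q: "(q \<longlongrightarrow> h) F" and t: "(t \<longlongrightarrow> 0) F"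
    and nz: "\<forall>\<^sub>F w in F. t w \<noteq> 0"
  shows "((\<lambda>w. (1 / t w) * (f (u w + t w *\<^sub>R q w) - f (u w))) \<longlongrightarrow> gateaux_deriv f x h) F"
proof -
  have "\<forall>w. \<exists>s. s \<in> {0..1} \<and>
      f (u w + t w *\<^sub>R q w) - f (u w) = t w * gateaux_deriv f (u w + (s * t w) *\<^sub>R q w) (q w)"
    using mvt_line[OF f] by blast
  then obtain s where s: "\<And>w. s w \<in> {0..1}"
      "\<And>w. f (u w + t w *\<^sub>R q w) - f (u w) = t w * gateaux_deriv f (u w + (s w * t w) *\<^sub>R q w) (q w)"
    by metis
  have "\<bar>s w * t w\<bar> \<le> \<bar>t w\<bar>" for w
    using s(1)[of w] by (simp add: abs_mult mult_left_le_one_le)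
  then have "((\<lambda>w. s w * t w) \<longlongrightarrow> 0) F"
    by (intro Lim_null_comparison[OF _ tendsto_rabs_zero[OF t]]) simp
  then have "((\<lambda>w. u w + (s w * t w) *\<^sub>R q w) \<longlongrightarrow> x + 0 *\<^sub>R h) F"
    by (intro tendsto_add tendsto_scaleR_tvs u q)
  then have "((\<lambda>w. (u w + (s w * t w) *\<^sub>R q w, q w)) \<longlongrightarrow> (x, h)) F"
    by (intro tendsto_Pair q) simp
  from continuous_on_tendsto_compose[OF gateaux_deriv_continuous[OF f] this]
  have "((\<lambda>w. gateaux_deriv f (u w + (s w * t w) *\<^sub>R q w) (q w)) \<longlongrightarrow> gateaux_deriv f x h) F"
    by simp
  then show ?thesis
    by (rule Lim_transform_eventually) (use nz in eventually_elim, simp add: s(2))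
qed

text \<open>Additivity: the step along \<open>h + k\<close> is split at
  \<open>x + t *\<^sub>R h\<close>, so that the second piece is a difference quotient with moving
  base point. Homogeneity: \<open>t \<mapsto> f (x + (t * c) *\<^sub>R h)\<close> is differentiated
  at 0 in two ways, which also covers \<open>c = 0\<close>.\<close>

lemma linear_gateaux_deriv:
  fixes f :: "'a::real_tvs \<Rightarrow> real"
  assumes f: "gateaux_smooth f"
  shows "linear (gateaux_deriv f x)"
proof (rule linearI)
  fix h k :: 'a
  have nz: "\<forall>\<^sub>F t in at (0::real). t \<noteq> 0" by (simp add: eventually_at_filter)
  have "((\<lambda>t::real. x + t *\<^sub>R h) \<longlongrightarrow> x + 0 *\<^sub>R h) (at 0)"
    by (intro tendsto_add tendsto_scaleR_tvs tendsto_const tendsto_ident_at)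
  then have "((\<lambda>t. (1 / t) * (f ((x + t *\<^sub>R h) + t *\<^sub>R k) - f (x + t *\<^sub>R h))) \<longlongrightarrow> gateaux_deriv f x k) (at 0)"
    by (intro tendsto_difference_quotient f tendsto_const tendsto_ident_at nz) simp
  moreover have "((\<lambda>t. (1 / t) * (f (x + t *\<^sub>R h) - f x)) \<longlongrightarrow> gateaux_deriv f x h) (at 0)"
    using gateaux_smooth_has_gateaux_deriv[OF f] by (simp add: has_gateaux_deriv_def)
  ultimately have "((\<lambda>t. (1 / t) * (f ((x + t *\<^sub>R h) + t *\<^sub>R k) - f (x + t *\<^sub>R h)) +
      (1 / t) * (f (x + t *\<^sub>R h) - f x)) \<longlongrightarrow> gateaux_deriv f x k + gateaux_deriv f x h) (at 0)"
    by (rule tendsto_add)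
  then have "has_gateaux_deriv f x (h + k) (gateaux_deriv f x k + gateaux_deriv f x h)"
    unfolding has_gateaux_deriv_def
    by (rule Lim_transform_eventually) (auto simp: algebra_simps intro!: always_eventually)
  from gateaux_deriv_eq[OF this]
  show "gateaux_deriv f x (h + k) = gateaux_deriv f x h + gateaux_deriv f x k" by simp
next
  fix c :: real and h :: 'a
  have "((\<lambda>t. f (x + t *\<^sub>R (c *\<^sub>R h))) has_real_derivative gateaux_deriv f x (c *\<^sub>R h)) (at 0)"
    using has_real_derivative_line[OF f, of x "c *\<^sub>R h" 0] by simp
  moreover have "((\<lambda>t. f (x + (t * c) *\<^sub>R h)) has_real_derivative gateaux_deriv f x h * c) (at 0)"
    using DERIV_chain2[where f = "\<lambda>t. f (x + t *\<^sub>R h)" and g = "\<lambda>t. t * c" and x = 0,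
        OF has_real_derivative_line[OF f] DERIV_cmult_right[OF DERIV_ident]]
    by simp
  ultimately show "gateaux_deriv f x (c *\<^sub>R h) = c *\<^sub>R gateaux_deriv f x h"
    using DERIV_unique by fastforce
qed

text \<open>\<open>Abs_dual\<close> is meaningful only on continuous linear functionals; linearity
  and continuity of the derivative in its direction supply this.\<close>

lemma pairing_gateaux_differential:
  assumes "gateaux_smooth F"
  shows "pairing (gateaux_differential F \<gamma>) = gateaux_deriv F \<gamma>"
proof -
  have "continuous_on UNIV (\<lambda>h. (\<gamma>, h))" by (intro continuous_intros)
  from continuous_on_compose2[OF gateaux_deriv_continuous[OF assms] this]
  have "continuous_on UNIV (gateaux_deriv F \<gamma>)" by simp
  then show ?thesis
    unfolding gateaux_differential_def
    by (intro Abs_dual_inverse) (simp add: linear_gateaux_deriv[OF assms])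
qed

text \<open>With \<open>?q\<close> the difference quotient of the inner map, its value at
  \<open>z + t *\<^sub>R h\<close> is \<open>\<gamma> z + t *\<^sub>R ?q t\<close>. The outer
  quotient thus has a fixed base point and a direction converging to \<open>l\<close>.\<close>

lemma gateaux_deriv_compose:
  fixes F :: "'b::real_tvs \<Rightarrow> real" and \<gamma> :: "'a::real_tvs \<Rightarrow> 'b"
  assumes F: "gateaux_smooth F" and \<gamma>: "has_gateaux_deriv \<gamma> z h l"
  shows "gateaux_deriv (F \<circ> \<gamma>) z h = gateaux_deriv F (\<gamma> z) l"
proof (rule gateaux_deriv_eq)
  let ?q = "\<lambda>t. (1 / t) *\<^sub>R (\<gamma> (z + t *\<^sub>R h) - \<gamma> z)"
  have nz: "\<forall>\<^sub>F t in at (0::real). t \<noteq> 0" by (simp add: eventually_at_filter)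
  have "((\<lambda>t. (1 / t) * (F (\<gamma> z + t *\<^sub>R ?q t) - F (\<gamma> z))) \<longlongrightarrow> gateaux_deriv F (\<gamma> z) l) (at 0)"
    by (intro tendsto_difference_quotient F tendsto_const tendsto_ident_at nz
        \<gamma>[unfolded has_gateaux_deriv_def])
  then show "has_gateaux_deriv (F \<circ> \<gamma>) z h (gateaux_deriv F (\<gamma> z) l)"
    unfolding has_gateaux_deriv_def
    by (rule Lim_transform_eventually) (use nz in eventually_elim, simp)
qed

section \<open>Iterated derivatives: expansion in coordinate directions and remainder
  estimates\<close>

lemma iter_deriv_append: "iter_deriv f (as @ bs) = iter_deriv (iter_deriv f bs) as"
proof (induction as)
  case (Cons a as)
  show ?case by (rule ext) (simp only: append_Cons iter_deriv.simps Cons)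
qed (simp add: fun_eq_iff)

lemma iter_deriv_zero: "iter_deriv (\<lambda>_. 0 :: real) hs x = 0"
  using iter_deriv_scale[OF gateaux_smooth_zero gateaux_smooth_zero, of 0 hs x] by simp

lemma iter_deriv_sum:
  fixes f :: "'i \<Rightarrow> 'a::real_tvs \<Rightarrow> real"
  assumes "\<And>i. i \<in> A \<Longrightarrow> gateaux_smooth (f i)"
  shows "iter_deriv (\<lambda>x. \<Sum>i\<in>A. f i x) hs x = (\<Sum>i\<in>A. iter_deriv (f i) hs x)"
  using assms
  by (induction A rule: infinite_finite_induct)
    (simp_all add: iter_deriv_zero iter_deriv_add gateaux_smooth_sum)

text \<open>The derivative along the sum, taken after those along \<open>bs\<close>, is linear in
  its direction. The derivatives along \<open>as\<close> then act on a linear combination of smooth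
  functions.\<close>

lemma iter_deriv_sum_direction:
  fixes f :: "'a::real_tvs \<Rightarrow> real"
  assumes f: "gateaux_smooth f"
  shows "iter_deriv f (as @ (\<Sum>b\<in>A. c b *\<^sub>R v b) # bs) x = (\<Sum>b\<in>A. c b * iter_deriv f (as @ v b # bs) x)"
proof -
  note s = gateaux_smooth_iter_deriv[OF f]
  have "iter_deriv f ((\<Sum>b\<in>A. c b *\<^sub>R v b) # bs) = (\<lambda>x. \<Sum>b\<in>A. c b * iter_deriv f (v b # bs) x)"
    using linear_gateaux_deriv[OF s, of bs] by (simp add: fun_eq_iff linear_sum linear_scale)
  then show ?thesis
    unfolding iter_deriv_append
    by (simp add: iter_deriv_sum gateaux_smooth_scale[OF s s] iter_deriv_scale[OF s s] del: iter_deriv.simps)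
qed

lemma iter_deriv_basis:
  fixes f :: "'a::euclidean_space \<Rightarrow> real"
  assumes "gateaux_smooth f"
  shows "iter_deriv f (as @ h # bs) x = (\<Sum>b\<in>Basis. (h \<bullet> b) * iter_deriv f (as @ b # bs) x)"
  using iter_deriv_sum_direction[OF assms, of as "\<lambda>b. h \<bullet> b" "\<lambda>b. b" Basis bs x]
  by (simp add: euclidean_representation)

text \<open>Arbitrary directions are expanded in the basis one at a time. Each expansion has
  \<open>DIM('a)\<close> terms with coefficients at most \<open>norm h\<close>. The induction
  removes the last entry of \<open>hs\<close>, so that the basis vector replacing it joins the list
  \<open>es\<close> on its right.\<close>

lemma iter_deriv_bound:
  fixes f :: "'a::euclidean_space \<Rightarrow> real"
  assumes f: "gateaux_smooth f"
    and M: "\<And>es. set es \<subseteq> Basis \<Longrightarrow> length es \<le> n \<Longrightarrow> \<bar>iter_deriv f es x\<bar> \<le> M"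
    and "set es \<subseteq> Basis" "length hs + length es \<le> n"
  shows "\<bar>iter_deriv f (hs @ es) x\<bar> \<le> (\<Prod>h\<leftarrow>hs. real DIM('a) * norm h) * M"
  using assms(3,4)
proof (induction hs arbitrary: es rule: rev_induct)
  case Nil
  then show ?case using M by simp
next
  case (snoc h hs)
  have M0: "0 \<le> M" using M[of "[]"] by (simp add: order_trans[OF abs_ge_zero])
  let ?P = "(\<Prod>h\<leftarrow>hs. real DIM('a) * norm h) * M"
  have "0 \<le> ?P" by (intro mult_nonneg_nonneg prod_list_nonneg M0) auto
  have "\<bar>iter_deriv f ((hs @ [h]) @ es) x\<bar> \<le> (\<Sum>b\<in>Basis. \<bar>(h \<bullet> b) * iter_deriv f (hs @ b # es) x\<bar>)"
    using iter_deriv_basis[OF f, of hs h es x] by simp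
  also have "\<dots> \<le> (\<Sum>b\<in>(Basis :: 'a set). norm h * ?P)"
    unfolding abs_mult
    by (intro sum_mono mult_mono snoc.IH Basis_le_norm) (use snoc.prems in auto)
  also have "\<dots> = (\<Prod>h\<leftarrow>hs @ [h]. real DIM('a) * norm h) * M" by simp
  finally show ?case .
qed

lemma iter_deriv_diff_bound:
  fixes f :: "'a::real_tvs \<Rightarrow> real"
  assumes f: "gateaux_smooth f"
    and M: "\<And>s. s \<in> {0..1} \<Longrightarrow> \<bar>iter_deriv f (h # hs) (x + s *\<^sub>R h)\<bar> \<le> M"
  shows "\<bar>iter_deriv f hs (x + h) - iter_deriv f hs x\<bar> \<le> M"
proof -
  obtain s where "s \<in> {0..1}" "iter_deriv f hs (x + h) - iter_deriv f hs x = iter_deriv f (h # hs) (x + s *\<^sub>R h)"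
    using mvt_line[OF gateaux_smooth_iter_deriv[OF f], of hs x 1 h] by auto
  then show ?thesis using M by simp
qed

text \<open>First-order Taylor estimate by two applications of the mean value theorem: the quotient
  is a derivative at an intermediate point, and its distance to the derivative at \<open>x\<close>
  is at most \<open>\<bar>t\<bar>\<close> times a second derivative.\<close>

lemma iter_deriv_quotient_bound:
  fixes f :: "'a::real_tvs \<Rightarrow> real"
  assumes f: "gateaux_smooth f" and t: "t \<noteq> 0"
    and M: "\<And>s. \<bar>s\<bar> \<le> \<bar>t\<bar> \<Longrightarrow> \<bar>iter_deriv f (h # h # hs) (x + s *\<^sub>R h)\<bar> \<le> M"
  shows "\<bar>(1 / t) * (iter_deriv f hs (x + t *\<^sub>R h) - iter_deriv f hs x) - iter_deriv f (h # hs) x\<bar> \<le> \<bar>t\<bar> * M"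
proof -
  have M0: "0 \<le> M" using M[of 0] by (simp add: order_trans[OF abs_ge_zero])
  obtain s where s: "s \<in> {0..1}"
    "iter_deriv f hs (x + t *\<^sub>R h) - iter_deriv f hs x = t * iter_deriv f (h # hs) (x + (s * t) *\<^sub>R h)"
    using mvt_line[OF gateaux_smooth_iter_deriv[OF f], of hs x t h] by auto
  obtain r where r: "r \<in> {0..1}"
    "iter_deriv f (h # hs) (x + (s * t) *\<^sub>R h) - iter_deriv f (h # hs) x =
      (s * t) * iter_deriv f (h # h # hs) (x + (r * (s * t)) *\<^sub>R h)"
    using mvt_line[OF gateaux_smooth_iter_deriv[OF f], of "h # hs" x "s * t" h] by auto
  have st: "\<bar>s * t\<bar> \<le> \<bar>t\<bar>" using s(1) by (simp add: abs_mult mult_left_le_one_le)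
  have "\<bar>r * (s * t)\<bar> \<le> \<bar>s * t\<bar>"
    using r(1) by (subst abs_mult) (simp add: mult_left_le_one_le)
  then have "\<bar>iter_deriv f (h # h # hs) (x + (r * (s * t)) *\<^sub>R h)\<bar> \<le> M"
    using st by (intro M) linarith
  then have "\<bar>s * t\<bar> * \<bar>iter_deriv f (h # h # hs) (x + (r * (s * t)) *\<^sub>R h)\<bar> \<le> \<bar>t\<bar> * M"
    using st by (intro mult_mono) auto
  then have "\<bar>iter_deriv f (h # hs) (x + (s * t) *\<^sub>R h) - iter_deriv f (h # hs) x\<bar> \<le> \<bar>t\<bar> * M"
    unfolding r(2) by (simp only: abs_mult)
  then show ?thesis unfolding s(2) using t by simp
qed

section \<open>Seminorm estimates\<close>

text \<open>A seminorm topology is not required to come from a directed family, whence the sum.\<close>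

lemma continuous_linear_seminorm_bound:
  fixes \<phi> :: "'a::{real_vector,topological_space} \<Rightarrow> real"
  assumes op: "\<And>U::'a set. open U \<longleftrightarrow> seminorm_open I p U"
    and sn: "\<And>i. i \<in> I \<Longrightarrow> is_seminorm (p i)"
    and lin: "linear \<phi>" and cont: "continuous_on UNIV \<phi>"
  obtains J c where "finite J" "J \<subseteq> I" "0 < c" "\<And>x. \<bar>\<phi> x\<bar> \<le> c * (\<Sum>i\<in>J. p i x)"
proof -
  have "open (\<phi> -` ball 0 1)" by (rule open_vimage[OF open_ball cont])
  moreover have "0 \<in> \<phi> -` ball 0 1" using linear_0[OF lin] by simp
  ultimately obtain J e where J: "finite J" "J \<subseteq> I" "0 < e"
      "\<forall>x. (\<forall>i\<in>J. p i (x - 0) < e) \<longrightarrow> x \<in> \<phi> -` ball 0 1"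
    unfolding op using seminorm_openE by metis
  have nn: "0 \<le> p i x" if "i \<in> J" for i x
    using is_seminorm_nonneg[OF sn] J(2) that by blast
  have "\<bar>\<phi> x\<bar> \<le> (1 / e) * (\<Sum>i\<in>J. p i x)" for x
  proof (rule field_le_epsilon)
    fix \<rho> :: real assume \<rho>: "0 < \<rho>"
    \<comment> \<open>The term \<open>e * \<rho>\<close> makes \<open>k\<close> positive and every
      seminorm of \<open>x\<close> strictly smaller than \<open>k\<close>, even if all of them
      vanish at \<open>x\<close>. Scaling by \<open>e / k\<close> then moves \<open>x\<close> into
      the neighbourhood where \<open>\<phi>\<close> is below 1.\<close>
    define k where "k = (\<Sum>i\<in>J. p i x) + e * \<rho>"
    have s0: "0 \<le> (\<Sum>i\<in>J. p i x)" using nn by (simp add: sum_nonneg)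
    have k: "0 < k" unfolding k_def using s0 mult_pos_pos[OF J(3) \<rho>] by linarith
    have "p i ((e / k) *\<^sub>R x) < e" if i: "i \<in> J" for i
    proof -
      have "p i x \<le> (\<Sum>i\<in>J. p i x)" by (rule member_le_sum[OF i nn J(1)]) auto
      then have "p i x < k" unfolding k_def using mult_pos_pos[OF J(3) \<rho>] by linarith
      moreover have "p i ((e / k) *\<^sub>R x) = \<bar>e / k\<bar> * p i x"
        using sn[of i] J(2) i unfolding is_seminorm_def by blast
      ultimately show ?thesis using k J(3) by (simp add: pos_divide_less_eq)
    qed
    then have "(e / k) *\<^sub>R x \<in> \<phi> -` ball 0 1" using J(4) by simp
    then have "\<bar>(e / k) * \<phi> x\<bar> < 1" by (simp add: linear_scale[OF lin])
    then have "\<bar>\<phi> x\<bar> < k / e" using k J(3) by (simp add: abs_mult field_simps)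
    then show "\<bar>\<phi> x\<bar> \<le> (1 / e) * (\<Sum>i\<in>J. p i x) + \<rho>"
      using J(3) by (simp add: k_def field_simps)
  qed
  then show thesis using J(1-3) that[of J "1 / e"] by simp
qed

text \<open>The finite order and compact support of a distribution acting on all smooth
  functions.\<close>

lemma pairing_sym_smooth_bound:
  fixes \<gamma> :: "('d::finite, 'n::finite) sym_smooth dual"
  obtains J c where "finite J" "J \<subseteq> UNIV \<times> {K. compact K \<and> K \<noteq> {}}" "0 < c"
    "\<And>f. \<bar>pairing \<gamma> f\<bar> \<le> c * (\<Sum>(n, K)\<in>J. sym_seminorm n K f)"
proof -
  have "is_seminorm ((\<lambda>(n, K). sym_seminorm n K) i)" if "i \<in> UNIV \<times> {K. compact K \<and> K \<noteq> {}}"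
    for i :: "nat \<times> ('d, 'n) config set"
    using that by (auto intro: sym_seminorm_is_seminorm)
  from continuous_linear_seminorm_bound[OF fun_cong[OF open_sym_smooth_def] this pairing_linear[of \<gamma>] pairing_continuous]
  obtain J c where "finite J" "J \<subseteq> UNIV \<times> {K. compact K \<and> K \<noteq> {}}" "0 < c"
    "\<And>f. \<bar>pairing \<gamma> f\<bar> \<le> c * (\<Sum>i\<in>J. (\<lambda>(n, K). sym_seminorm n K) i f)"
    by blast
  then show thesis by (intro that[of J c]) (simp_all add: case_prod_unfold)
qed

lemma pairing_dual_bound:
  fixes \<Phi> :: "'a::real_tvs dual dual"
  obtains J c where "finite J" "J \<subseteq> {B. tvs_bounded B \<and> B \<noteq> {}}" "0 < c"
    "\<And>\<gamma>. \<bar>pairing \<Phi> \<gamma>\<bar> \<le> c * (\<Sum>B\<in>J. dual_seminorm B \<gamma>)"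
proof -
  have "is_seminorm (dual_seminorm B)" if "B \<in> {B. tvs_bounded B \<and> B \<noteq> {}}" for B :: "'a set"
    using that by (auto intro: dual_seminorm_is_seminorm)
  from continuous_linear_seminorm_bound[OF fun_cong[OF open_dual_def] this pairing_linear[of \<Phi>] pairing_continuous]
  show thesis using that by blast
qed

lemma iter_deriv_le_sym_seminorm:
  assumes "compact K" "z \<in> K" "set es \<subseteq> Basis" "length es \<le> n"
  shows "\<bar>iter_deriv (apply_sym f) es z\<bar> \<le> sym_seminorm n K f"
proof -
  have "(\<lambda>(es, z). \<bar>iter_deriv (apply_sym f) es z\<bar>) (es, z) \<le> sym_seminorm n K f"
    unfolding sym_seminorm_def using assms by (intro cSUP_upper sym_seminorm_bdd_above) auto
  then show ?thesis by simp
qed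

lemma sym_seminorm_leI:
  assumes "K \<noteq> {}"
    "\<And>es z. set es \<subseteq> Basis \<Longrightarrow> length es \<le> n \<Longrightarrow> z \<in> K \<Longrightarrow> \<bar>iter_deriv (apply_sym f) es z\<bar> \<le> e"
  shows "sym_seminorm n K f \<le> e"
  unfolding sym_seminorm_def
  by (rule cSUP_least) (use assms in \<open>auto intro: exI[of _ "[]"]\<close>)

lemma iter_deriv_le_sym_seminorm_norm:
  fixes f :: "('d::finite, 'n::finite) sym_smooth"
  assumes "compact K" "z \<in> K" "length hs \<le> n"
  shows "\<bar>iter_deriv (apply_sym f) hs z\<bar> \<le> (\<Prod>h\<leftarrow>hs. real DIM(('d, 'n) config) * norm h) * sym_seminorm n K f"
  using iter_deriv_bound[OF apply_sym_smooth[of f] iter_deriv_le_sym_seminorm[OF assms(1,2)], where es = "[]" and hs = hs and n = n] assms(3)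
  by simp

text \<open>The open unit ball of the seminorm is a neighbourhood of 0, hence absorbs
  \<open>B\<close>; the scaling factor is the bound.\<close>

lemma tvs_bounded_sym_seminorm:
  fixes B :: "('d::finite, 'n::finite) sym_smooth set"
  assumes B: "tvs_bounded B" and K: "compact K" "K \<noteq> {}"
  obtains M where "0 < M" "\<And>f. f \<in> B \<Longrightarrow> sym_seminorm n K f \<le> M"
proof -
  let ?U = "{f. sym_seminorm n K f < 1}"
  have "seminorm_open (UNIV \<times> {K. compact K \<and> K \<noteq> {}}) (\<lambda>(n, K). sym_seminorm n K)
      {f :: ('d, 'n) sym_smooth. (\<lambda>(n, K). sym_seminorm n K) (n, K) (f - 0) < 1}"
    by (rule seminorm_open_ball) (use K in \<open>auto intro: sym_seminorm_is_seminorm\<close>)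
  then have "open ?U" by (simp add: open_sym_smooth_def)
  moreover have "0 \<in> ?U" using is_seminorm_zero[OF sym_seminorm_is_seminorm[OF K]] by simp
  ultimately obtain r where r: "r > 0" "\<forall>s\<ge>r. B \<subseteq> (\<lambda>x. s *\<^sub>R x) ` ?U"
    using B unfolding tvs_bounded_def by blast
  have "sym_seminorm n K f \<le> r" if f: "f \<in> B" for f
  proof -
    have "f \<in> (\<lambda>x. r *\<^sub>R x) ` ?U" using r f by blast
    then obtain u where "f = r *\<^sub>R u" "sym_seminorm n K u < 1" by blast
    then show ?thesis
      using r(1) sym_seminorm_is_seminorm[OF K, of n] by (simp add: is_seminorm_def)
  qed
  then show thesis using that r(1) by blast
qed

lemma dual_seminorm_leI:
  assumes "B \<noteq> {}" "\<And>f. f \<in> B \<Longrightarrow> \<bar>pairing \<gamma> f\<bar> \<le> e"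
  shows "dual_seminorm B \<gamma> \<le> e"
  unfolding dual_seminorm_def by (rule cSUP_least) (use assms in auto)

text \<open>Strong convergence is checked through a rate \<open>e\<close> that may depend on the
  bounded set but not on the element of it.\<close>

lemma tendsto_dualI:
  fixes \<gamma> :: "'b \<Rightarrow> 'a::real_tvs dual"
  assumes "\<And>B. tvs_bounded B \<Longrightarrow> B \<noteq> {} \<Longrightarrow>
    \<exists>e. (e \<longlongrightarrow> 0) F \<and> (\<forall>\<^sub>F w in F. \<forall>f\<in>B. \<bar>pairing (\<gamma> w) f - pairing l f\<bar> \<le> e w)"
  shows "(\<gamma> \<longlongrightarrow> l) F"
  unfolding tendsto_dual_iff
proof
  fix B :: "'a set" assume "B \<in> {B. tvs_bounded B \<and> B \<noteq> {}}"
  then have B: "tvs_bounded B" "B \<noteq> {}" by auto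
  obtain e where e: "(e \<longlongrightarrow> 0) F" "\<forall>\<^sub>F w in F. \<forall>f\<in>B. \<bar>pairing (\<gamma> w) f - pairing l f\<bar> \<le> e w"
    using assms[OF B] by blast
  have "\<forall>\<^sub>F w in F. norm (dual_seminorm B (\<gamma> w - l)) \<le> e w"
    using e(2)
  proof eventually_elim
    case (elim w)
    have "dual_seminorm B (\<gamma> w - l) \<le> e w"
      by (rule dual_seminorm_leI[OF B(2)]) (use elim in \<open>simp add: minus_dual.rep_eq\<close>)
    then show ?case
      using is_seminorm_nonneg[OF dual_seminorm_is_seminorm[OF B]] by simp
  qed
  then show "((\<lambda>w. dual_seminorm B (\<gamma> w - l)) \<longlongrightarrow> 0) F" using e(1) by (rule Lim_null_comparison)
qed

section \<open>Derivatives of Dirac masses\<close>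

text \<open>These are the derivatives of the map sending \<open>z\<close> to its Dirac mass, hence
  without the sign of distributional derivatives. Continuity in the test function holds because the
  value is bounded by a constant times the seminorm of order \<open>length hs\<close> on the single
  point \<open>z\<close>.\<close>

lift_definition dirac_deriv ::
  "('d::finite, 'n::finite) config list \<Rightarrow> ('d, 'n) config \<Rightarrow> ('d, 'n) sym_smooth dual"
  is "\<lambda>hs z f. iter_deriv (apply_sym f) hs z"
proof (intro conjI)
  fix hs and z :: "('d, 'n) config"
  let ?\<phi> = "\<lambda>f :: ('d, 'n) sym_smooth. iter_deriv (apply_sym f) hs z"
  show lin: "linear ?\<phi>"
    by (rule linearI) (simp_all add: plus_sym_smooth.rep_eq[abs_def] scaleR_sym_smooth.rep_eq[abs_def]
        iter_deriv_add[OF apply_sym_smooth apply_sym_smooth] iter_deriv_scale[OF apply_sym_smooth apply_sym_smooth])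
  let ?P = "\<Prod>h\<leftarrow>hs. real DIM(('d, 'n) config) * norm h"
  show "continuous_on UNIV ?\<phi>"
    unfolding continuous_on_def
  proof
    fix f :: "('d, 'n) sym_smooth"
    have "((\<lambda>g. g) \<longlongrightarrow> f) (at f within UNIV)" by (rule tendsto_ident_at)
    then have "((\<lambda>g. sym_seminorm (length hs) {z} (g - f)) \<longlongrightarrow> 0) (at f within UNIV)"
      unfolding tendsto_sym_smooth_iff by (drule_tac bspec[of _ _ "(length hs, {z})"]) auto
    then have "((\<lambda>g. ?P * sym_seminorm (length hs) {z} (g - f)) \<longlongrightarrow> 0) (at f within UNIV)"
      by (rule tendsto_mult_right_zero)
    then have "((\<lambda>g. ?\<phi> (g - f)) \<longlongrightarrow> 0) (at f within UNIV)"
      by (rule Lim_null_comparison[rotated], unfold real_norm_def, intro always_eventually allI)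
        (rule iter_deriv_le_sym_seminorm_norm, auto)
    then show "(?\<phi> \<longlongrightarrow> ?\<phi> f) (at f within UNIV)"
      by (simp add: linear_diff[OF lin] LIM_zero_cancel)
  qed
qed

lemma dirac_deriv_Nil: "dirac_deriv [] = dirac_tensor"
  by (rule ext, rule dual_eqI) (simp add: dirac_deriv.rep_eq dirac_tensor.rep_eq)

lemma pairing_sum: "pairing (\<Sum>i\<in>A. \<gamma> i) f = (\<Sum>i\<in>A. pairing (\<gamma> i) f)"
  by (induction A rule: infinite_finite_induct) (simp_all add: zero_dual.rep_eq plus_dual.rep_eq)

lemma dirac_deriv_basis:
  "dirac_deriv (as @ h # bs) z = (\<Sum>b\<in>Basis. (h \<bullet> b) *\<^sub>R dirac_deriv (as @ b # bs) z)"
proof (rule dual_eqI)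
  fix f
  show "pairing (dirac_deriv (as @ h # bs) z) f =
      pairing (\<Sum>b\<in>Basis. (h \<bullet> b) *\<^sub>R dirac_deriv (as @ b # bs) z) f"
    unfolding dirac_deriv.rep_eq pairing_sum scaleR_dual.rep_eq
    by (rule iter_deriv_basis[OF apply_sym_smooth])
qed

text \<open>The Taylor remainder is \<open>\<bar>t\<bar>\<close> times a derivative of order
  \<open>length hs + 2\<close>, which is bounded uniformly over a bounded set of test functions. The
  ball of radius \<open>norm h\<close> contains all points involved once
  \<open>\<bar>t\<bar> < 1\<close>.\<close>

lemma has_gateaux_deriv_dirac_deriv:
  fixes z h :: "('d::finite, 'n::finite) config"
  shows "has_gateaux_deriv (dirac_deriv hs) z h (dirac_deriv (h # hs) z)"
  unfolding has_gateaux_deriv_def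
proof (rule tendsto_dualI)
  fix B :: "('d, 'n) sym_smooth set" assume B: "tvs_bounded B" "B \<noteq> {}"
  let ?n = "length hs + 2" and ?K = "cball z (norm h)"
  let ?P = "\<Prod>h\<leftarrow>h # h # hs. real DIM(('d, 'n) config) * norm h"
  obtain M where M: "0 < M" "\<And>f. f \<in> B \<Longrightarrow> sym_seminorm ?n ?K f \<le> M"
    using tvs_bounded_sym_seminorm[OF B(1) compact_cball[of z "norm h"], of ?n] by auto
  have P0: "0 \<le> ?P" by (rule prod_list_nonneg) auto
  have "\<bar>pairing ((1 / t) *\<^sub>R (dirac_deriv hs (z + t *\<^sub>R h) - dirac_deriv hs z)) f -
      pairing (dirac_deriv (h # hs) z) f\<bar> \<le> \<bar>t\<bar> * (?P * M)"
    if t: "t \<noteq> 0" "\<bar>t\<bar> < 1" and f: "f \<in> B" for t f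
  proof -
    have "\<bar>iter_deriv (apply_sym f) (h # h # hs) (z + s *\<^sub>R h)\<bar> \<le> ?P * M" if "\<bar>s\<bar> \<le> \<bar>t\<bar>" for s
    proof -
      have "z + s *\<^sub>R h \<in> ?K"
        using that t(2) by (simp add: dist_norm mult_left_le_one_le)
      then have "\<bar>iter_deriv (apply_sym f) (h # h # hs) (z + s *\<^sub>R h)\<bar> \<le> ?P * sym_seminorm ?n ?K f"
        by (intro iter_deriv_le_sym_seminorm_norm) auto
      also have "\<dots> \<le> ?P * M" by (rule mult_left_mono[OF M(2)[OF f] P0])
      finally show ?thesis .
    qed
    from iter_deriv_quotient_bound[OF apply_sym_smooth t(1) this]
    show ?thesis
      by (simp add: scaleR_dual.rep_eq minus_dual.rep_eq dirac_deriv.rep_eq del: iter_deriv.simps)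
  qed
  moreover have "\<forall>\<^sub>F t in at (0::real). t \<noteq> 0 \<and> \<bar>t\<bar> < 1"
    unfolding eventually_at by (intro exI[of _ 1]) auto
  ultimately have "\<forall>\<^sub>F t in at 0. \<forall>f\<in>B. \<bar>pairing ((1 / t) *\<^sub>R (dirac_deriv hs (z + t *\<^sub>R h) - dirac_deriv hs z)) f -
      pairing (dirac_deriv (h # hs) z) f\<bar> \<le> \<bar>t\<bar> * (?P * M)"
    by (auto elim!: eventually_mono)
  moreover have "((\<lambda>t::real. \<bar>t\<bar> * (?P * M)) \<longlongrightarrow> 0) (at 0)"
    by (intro tendsto_mult_left_zero tendsto_rabs_zero tendsto_ident_at)
  ultimately show "\<exists>e. (e \<longlongrightarrow> 0) (at 0) \<and> (\<forall>\<^sub>F t in at 0. \<forall>f\<in>B.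
      \<bar>pairing ((1 / t) *\<^sub>R (dirac_deriv hs (z + t *\<^sub>R h) - dirac_deriv hs z)) f -
      pairing (dirac_deriv (h # hs) z) f\<bar> \<le> e t)" by blast
qed

text \<open>For fixed directions, a Lipschitz estimate near \<open>z\<close>, uniform over
  \<open>B\<close>: the mean value theorem costs one more derivative, bounded on the unit ball
  around \<open>z\<close>.\<close>

lemma continuous_on_dirac_deriv:
  "continuous_on UNIV (dirac_deriv hs :: ('d::finite, 'n::finite) config \<Rightarrow> _)"
  unfolding continuous_on_def
proof (intro ballI tendsto_dualI)
  fix z :: "('d, 'n) config" and B :: "('d, 'n) sym_smooth set"
  assume B: "tvs_bounded B" "B \<noteq> {}"
  let ?n = "length hs + 1" and ?K = "cball z 1"
  let ?P = "\<Prod>h\<leftarrow>hs. real DIM(('d, 'n) config) * norm h"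
  obtain M where M: "0 < M" "\<And>f. f \<in> B \<Longrightarrow> sym_seminorm ?n ?K f \<le> M"
    using tvs_bounded_sym_seminorm[OF B(1) compact_cball[of z 1], of ?n] by auto
  have P0: "0 \<le> ?P" by (rule prod_list_nonneg) auto
  let ?e = "\<lambda>w. real DIM(('d, 'n) config) * norm (w - z) * (?P * M)"
  have "\<bar>pairing (dirac_deriv hs w) f - pairing (dirac_deriv hs z) f\<bar> \<le> ?e w"
    if w: "dist w z < 1" and f: "f \<in> B" for w f
  proof -
    have "\<bar>iter_deriv (apply_sym f) ((w - z) # hs) (z + s *\<^sub>R (w - z))\<bar> \<le> ?e w" if "s \<in> {0..1}" for s
    proof -
      have "norm (s *\<^sub>R (w - z)) \<le> norm (w - z)" using that by (simp add: mult_left_le_one_le)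
      then have "z + s *\<^sub>R (w - z) \<in> ?K"
        using w by (simp add: dist_norm)
      then have "\<bar>iter_deriv (apply_sym f) ((w - z) # hs) (z + s *\<^sub>R (w - z))\<bar> \<le>
          (\<Prod>h\<leftarrow>(w - z) # hs. real DIM(('d, 'n) config) * norm h) * sym_seminorm ?n ?K f"
        by (intro iter_deriv_le_sym_seminorm_norm) auto
      also have "\<dots> \<le> (\<Prod>h\<leftarrow>(w - z) # hs. real DIM(('d, 'n) config) * norm h) * M"
        by (rule mult_left_mono[OF M(2)[OF f]], rule prod_list_nonneg) auto
      also have "\<dots> = ?e w" by simp
      finally show ?thesis .
    qed
    from iter_deriv_diff_bound[OF apply_sym_smooth this]
    show ?thesis by (simp add: dirac_deriv.rep_eq)
  qed
  then have "\<forall>\<^sub>F w in at z within UNIV. \<forall>f\<in>B. \<bar>pairing (dirac_deriv hs w) f - pairing (dirac_deriv hs z) f\<bar> \<le> ?e w"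
    unfolding eventually_at by (intro exI[of _ 1]) auto
  moreover have "(?e \<longlongrightarrow> 0) (at z within UNIV)"
    by (intro tendsto_mult_left_zero tendsto_mult_right_zero tendsto_norm_zero LIM_zero tendsto_ident_at)
  ultimately show "\<exists>e. (e \<longlongrightarrow> 0) (at z within UNIV) \<and> (\<forall>\<^sub>F w in at z within UNIV. \<forall>f\<in>B.
      \<bar>pairing (dirac_deriv hs w) f - pairing (dirac_deriv hs z) f\<bar> \<le> e w)" by blast
qed

lemma continuous_on_scaleR_tvs:
  fixes g :: "'a::topological_space \<Rightarrow> 'b::real_tvs"
  shows "continuous_on S f \<Longrightarrow> continuous_on S g \<Longrightarrow> continuous_on S (\<lambda>x. f x *\<^sub>R g x)"
  unfolding continuous_on_def by (blast intro: tendsto_scaleR_tvs)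

text \<open>Joint continuity in point and directions. The variable directions are expanded one by
  one, from the last, into fixed basis vectors collected in \<open>es\<close>; the coefficients are
  continuous, and with all directions fixed only continuity in the point remains.\<close>

lemma continuous_on_dirac_deriv_map:
  "continuous_on UNIV (\<lambda>p. dirac_deriv (map (snd p) xs @ es) (fst p) ::
    ('d::finite, 'n::finite) sym_smooth dual)"
proof (induction xs arbitrary: es rule: rev_induct)
  case Nil
  have "continuous_on UNIV (fst :: ('d, 'n) config \<times> _ \<Rightarrow> _)" by (intro continuous_intros)
  from continuous_on_compose2[OF continuous_on_dirac_deriv this]
  show ?case by simp
next
  case (snoc x xs)
  have "continuous_on UNIV (\<lambda>p :: ('d, 'n) config \<times> _. snd p x)"
    by (rule continuous_on_compose2[of UNIV "\<lambda>h. h x" UNIV snd])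
      (auto intro: continuous_on_product_coordinates continuous_on_snd continuous_on_id)
  then have cont: "continuous_on UNIV (\<lambda>p :: ('d, 'n) config \<times> _.
      \<Sum>b\<in>Basis. (snd p x \<bullet> b) *\<^sub>R dirac_deriv (map (snd p) xs @ b # es) (fst p))"
    by (intro continuous_on_sum continuous_on_scaleR_tvs snoc.IH continuous_on_inner continuous_on_const)
  have "(\<Sum>b\<in>Basis. (snd p x \<bullet> b) *\<^sub>R dirac_deriv (map (snd p) xs @ b # es) (fst p)) =
      dirac_deriv (map (snd p) (xs @ [x]) @ es) (fst p)"
    for p :: "('d, 'n) config \<times> _"
    using dirac_deriv_basis[of "map (snd p) xs" "snd p x" es "fst p"] by simp
  then show ?case by (rule continuous_on_eq[OF cont])
qed

lemma dirac_tensor_smooth: "gateaux_smooth (dirac_tensor :: ('d::finite, 'n::finite) config \<Rightarrow> _)"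
proof (rule gateaux_smoothI(1)[OF _ has_gateaux_deriv_dirac_deriv])
  show "dirac_deriv [] z = dirac_tensor z" for z :: "('d, 'n) config"
    by (simp only: dirac_deriv_Nil)
  show "continuous_on UNIV (\<lambda>p. dirac_deriv (map (snd p) [0..<n]) (fst p) :: ('d, 'n) sym_smooth dual)" for n
    using continuous_on_dirac_deriv_map[of "[0..<n]" "[]"] by (simp only: append_Nil2)
qed

section \<open>Symmetrisation has no effect on functionals of symmetric functions\<close>

lemma dirac_tensor_permute:
  "\<pi> permutes UNIV \<Longrightarrow> dirac_tensor (permute_config \<pi> z) = dirac_tensor z"
  by (rule dual_eqI) (simp add: dirac_tensor.rep_eq apply_sym_permute)

text \<open>All summands of the symmetrisation coincide in the dual, and their number cancels the
  factorial.\<close>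

lemma iota_Lio_eq_dirac_tensor: "iota_Lio = dirac_tensor"
proof
  fix z :: "('d::finite, 'n::finite) config"
  have "card {\<pi> :: 'n \<Rightarrow> 'n. \<pi> permutes UNIV} = fact CARD('n)"
    by (rule card_permutations) auto
  then show "iota_Lio z = dirac_tensor z"
    by (intro dual_eqI)
      (simp add: iota_Lio_def scaleR_dual.rep_eq pairing_sum dirac_tensor_permute)
qed

section \<open>Semireflexivity\<close>

text \<open>Pointwise smallness propagates to the derivatives by \<open>|u'| \<le> 2 |u| / t + t |u''|\<close>, with \<open>t\<close>
  chosen first.\<close>

lemma sym_seminorm_small:
  fixes M :: "nat \<Rightarrow> ('d::finite, 'n::finite) config set \<Rightarrow> real"
  assumes "compact K" "K \<noteq> {}" "0 < \<epsilon>"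
  shows "\<exists>\<delta>>0. \<exists>Z. finite Z \<and> (\<forall>u. (\<forall>m L. compact L \<longrightarrow> L \<noteq> {} \<longrightarrow> sym_seminorm m L u \<le> M m L) \<longrightarrow>
    (\<forall>z\<in>Z. \<bar>apply_sym u z\<bar> \<le> \<delta>) \<longrightarrow> sym_seminorm n K u \<le> \<epsilon>)"
  using assms
proof (induction n arbitrary: K \<epsilon>)
  case (0 K \<epsilon>)
  \<comment> \<open>The closed neighbourhood of \<open>K\<close> of radius 1 contains every segment
    of length at most 1 starting in \<open>K\<close>; the mean value estimates take place
    there.\<close>
  define L where "L = {x + y | x y. x \<in> K \<and> y \<in> cball (0 :: ('d, 'n) config) 1}"
  have L: "compact L" unfolding L_def by (intro compact_sums 0 compact_cball)
  have "k \<in> L" if "k \<in> K" for k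
    unfolding L_def using that by (intro CollectI exI[of _ k] exI[of _ 0]) auto
  then have "L \<noteq> {}" using 0(2) by auto
  define D where "D = real DIM(('d, 'n) config)"
  have D: "0 < D" unfolding D_def by (simp add: DIM_positive del: DIM_cart)
  \<comment> \<open>The net is so fine that the first-order bound lets \<open>u\<close> vary by at
    most \<open>\<epsilon> / 2\<close> between a point of \<open>K\<close> and a nearby net point.
    The added 1 keeps the denominator positive.\<close>
  define r where "r = min 1 (\<epsilon> / (2 * D * (\<bar>M 1 L\<bar> + 1)))"
  have r: "0 < r" "r \<le> 1" using D 0(3) by (simp_all add: r_def)
  have "r \<le> \<epsilon> / (2 * D * (\<bar>M 1 L\<bar> + 1))" by (simp add: r_def)
  then have "r * (2 * D * (\<bar>M 1 L\<bar> + 1)) \<le> \<epsilon>" using D by (subst (asm) pos_le_divide_eq) auto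
  then have rM: "D * r * (\<bar>M 1 L\<bar> + 1) \<le> \<epsilon> / 2" by (simp add: algebra_simps)
  obtain Z where Z: "finite Z" "Z \<subseteq> K" "K \<subseteq> (\<Union>z\<in>Z. ball z r)"
    using compactE_image[OF 0(1), of K "\<lambda>z. ball z r"] r(1) by (metis UN_I centre_in_ball open_ball subsetI)
  have "sym_seminorm 0 K u \<le> \<epsilon>"
    if u: "\<And>m L. compact L \<Longrightarrow> L \<noteq> {} \<Longrightarrow> sym_seminorm m L u \<le> M m L"
      and small: "\<And>z. z \<in> Z \<Longrightarrow> \<bar>apply_sym u z\<bar> \<le> \<epsilon> / 2" for u
  proof (rule sym_seminorm_leI[OF 0(2)])
    fix es x assume es: "length (es :: ('d, 'n) config list) \<le> 0" and x: "x \<in> K"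
    obtain z where z: "z \<in> Z" "dist z x < r" using Z(3) x by auto
    have "\<bar>iter_deriv (apply_sym u) [x - z] (z + s *\<^sub>R (x - z))\<bar> \<le> D * r * (\<bar>M 1 L\<bar> + 1)" if s: "s \<in> {0..1}" for s
    proof -
      have xz: "norm (x - z) \<le> r" using z(2) by (simp add: dist_norm norm_minus_commute)
      moreover have "norm (s *\<^sub>R (x - z)) \<le> norm (x - z)" using s by (simp add: mult_left_le_one_le)
      ultimately have "z + s *\<^sub>R (x - z) \<in> L"
        unfolding L_def using z(1) Z(2) r(2)
        by (intro CollectI exI[of _ z] exI[of _ "s *\<^sub>R (x - z)"]) auto
      then have "\<bar>iter_deriv (apply_sym u) [x - z] (z + s *\<^sub>R (x - z))\<bar>
          \<le> (\<Prod>h\<leftarrow>[x - z]. real DIM(('d, 'n) config) * norm h) * sym_seminorm 1 L u"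
        by (intro iter_deriv_le_sym_seminorm_norm L) auto
      also have "\<dots> \<le> (\<Prod>h\<leftarrow>[x - z]. real DIM(('d, 'n) config) * norm h) * (\<bar>M 1 L\<bar> + 1)"
        by (intro mult_left_mono order_trans[OF u[OF L \<open>L \<noteq> {}\<close>]] prod_list_nonneg) auto
      also have "\<dots> \<le> D * r * (\<bar>M 1 L\<bar> + 1)"
        using xz D by (intro mult_right_mono) (simp_all add: D_def[symmetric] del: DIM_cart)
      finally show ?thesis .
    qed
    from iter_deriv_diff_bound[OF apply_sym_smooth this]
    have "\<bar>apply_sym u x - apply_sym u z\<bar> \<le> \<epsilon> / 2" using rM by simp
    then have "\<bar>apply_sym u x\<bar> \<le> \<epsilon>" using small[OF z(1)] by linarith
    then show "\<bar>iter_deriv (apply_sym u) es x\<bar> \<le> \<epsilon>" using es by simp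
  qed
  then show ?case using Z(1) 0(3) by (intro exI[of _ "\<epsilon> / 2"] conjI exI[of _ Z]) auto
next
  case (Suc n K \<epsilon>)
  define L where "L = {x + y | x y. x \<in> K \<and> y \<in> cball (0 :: ('d, 'n) config) 1}"
  have L: "compact L" unfolding L_def by (intro compact_sums Suc.prems compact_cball)
  have KL: "k \<in> L" if "k \<in> K" for k
    unfolding L_def using that by (intro CollectI exI[of _ k] exI[of _ 0]) auto
  then have L0: "L \<noteq> {}" using Suc.prems(2) by auto
  \<comment> \<open>The step is fixed before the net: it makes the second-order Taylor term at most
    \<open>\<epsilon> / 2\<close>.\<close>
  define t where "t = min 1 (\<epsilon> / (2 * (\<bar>M (Suc (Suc n)) L\<bar> + 1)))"
  have t: "0 < t" "t \<le> 1" using Suc.prems(3) by (simp_all add: t_def)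
  have "t \<le> \<epsilon> / (2 * (\<bar>M (Suc (Suc n)) L\<bar> + 1))" by (simp add: t_def)
  then have tM: "t * (\<bar>M (Suc (Suc n)) L\<bar> + 1) \<le> \<epsilon> / 2" by (simp add: field_simps)
  \<comment> \<open>The induction hypothesis is used on \<open>L\<close>, since
    \<open>x + t *\<^sub>R e\<close> may leave \<open>K\<close>. Two values of size at most
    \<open>\<epsilon> * t / 4\<close>, divided by \<open>t\<close>, contribute the other
    \<open>\<epsilon> / 2\<close>.\<close>
  obtain \<delta> Z where \<delta>: "0 < \<delta>" "finite Z" and IH:
    "\<And>u. (\<forall>m L. compact L \<longrightarrow> L \<noteq> {} \<longrightarrow> sym_seminorm m L u \<le> M m L) \<Longrightarrow>
      (\<forall>z\<in>Z. \<bar>apply_sym u z\<bar> \<le> \<delta>) \<Longrightarrow> sym_seminorm n L u \<le> \<epsilon> * t / 4"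
    using Suc.IH[OF L L0, of "\<epsilon> * t / 4"] t(1) Suc.prems(3) by (auto simp del: mult_pos_pos intro: mult_pos_pos)
  have "sym_seminorm (Suc n) K u \<le> \<epsilon>"
    if u: "\<forall>m L. compact L \<longrightarrow> L \<noteq> {} \<longrightarrow> sym_seminorm m L u \<le> M m L"
      and small: "\<forall>z\<in>Z. \<bar>apply_sym u z\<bar> \<le> \<delta>" for u
  proof (rule sym_seminorm_leI[OF Suc.prems(2)])
    fix es x assume es: "set es \<subseteq> Basis" "length (es :: ('d, 'n) config list) \<le> Suc n" and x: "x \<in> K"
    have low: "\<bar>iter_deriv (apply_sym u) es' y\<bar> \<le> \<epsilon> * t / 4"
      if "set es' \<subseteq> Basis" "length es' \<le> n" "y \<in> L" for es' y
      using iter_deriv_le_sym_seminorm[OF L that(3,1,2)] IH[OF u small] by (rule order_trans)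
    show "\<bar>iter_deriv (apply_sym u) es x\<bar> \<le> \<epsilon>"
    proof (cases "length es \<le> n")
      case True
      have "\<epsilon> * t \<le> \<epsilon>" using t Suc.prems(3) by (simp add: mult_left_le)
      then show ?thesis using low[OF es(1) True KL[OF x]] Suc.prems(3) by linarith
    next
      case False
      then obtain e es' where e: "es = e # es'" "length es' = n" using es(2) by (cases es) auto
      then have eb: "e \<in> Basis" "set es' \<subseteq> Basis" using es(1) by auto
      have inL: "x + s *\<^sub>R e \<in> L" if "\<bar>s\<bar> \<le> \<bar>t\<bar>" for s
        unfolding L_def using that t x eb(1)
        by (intro CollectI exI[of _ x] exI[of _ "s *\<^sub>R e"]) auto
      have "\<bar>iter_deriv (apply_sym u) (e # e # es') (x + s *\<^sub>R e)\<bar> \<le> \<bar>M (Suc (Suc n)) L\<bar> + 1"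
        if "\<bar>s\<bar> \<le> \<bar>t\<bar>" for s
      proof -
        have "\<bar>iter_deriv (apply_sym u) (e # e # es') (x + s *\<^sub>R e)\<bar> \<le> sym_seminorm (Suc (Suc n)) L u"
          using eb e(2) by (intro iter_deriv_le_sym_seminorm L inL that) auto
        moreover have "sym_seminorm (Suc (Suc n)) L u \<le> M (Suc (Suc n)) L" using u L L0 by blast
        ultimately show ?thesis by linarith
      qed
      from iter_deriv_quotient_bound[OF apply_sym_smooth _ this, of t]
      have q: "\<bar>(1 / t) * (iter_deriv (apply_sym u) es' (x + t *\<^sub>R e) - iter_deriv (apply_sym u) es' x)
          - iter_deriv (apply_sym u) (e # es') x\<bar> \<le> \<epsilon> / 2"
        using t tM by (simp del: iter_deriv.simps)
      have "\<bar>iter_deriv (apply_sym u) es' (x + t *\<^sub>R e) - iter_deriv (apply_sym u) es' x\<bar> \<le> \<epsilon> * t / 2"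
        using low[OF eb(2) eq_refl[OF e(2)] inL[OF order_refl]] low[OF eb(2) eq_refl[OF e(2)] KL[OF x]]
        by linarith
      then have "\<bar>(1 / t) * (iter_deriv (apply_sym u) es' (x + t *\<^sub>R e) - iter_deriv (apply_sym u) es' x)\<bar> \<le> \<epsilon> / 2"
        using t(1) by (simp add: abs_mult field_simps)
      then show ?thesis using q unfolding e(1) by linarith
    qed
  qed
  then show ?case using \<delta> by blast
qed

text \<open>Finite-dimensional separation in disguise: a near-minimiser of the squared distance to the
  target \<open>c\<close> yields the separating functional.\<close>

lemma convex_approximation:
  fixes \<phi> :: "'i \<Rightarrow> 'a::real_vector \<Rightarrow> real"
  assumes I: "finite I" and lin: "\<And>i. i \<in> I \<Longrightarrow> linear (\<phi> i)"
    and C: "convex C" "C \<noteq> {}" and bdd: "\<And>i x. i \<in> I \<Longrightarrow> x \<in> C \<Longrightarrow> \<bar>\<phi> i x\<bar> \<le> R i"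
    and dom: "\<And>a \<beta>. (\<And>x. x \<in> C \<Longrightarrow> (\<Sum>i\<in>I. a i * \<phi> i x) \<le> \<beta>) \<Longrightarrow> (\<Sum>i\<in>I. a i * c i) \<le> \<beta>"
    and \<epsilon>: "0 < \<epsilon>"
  obtains x where "x \<in> C" "(\<Sum>i\<in>I. (\<phi> i x - c i)\<^sup>2) < \<epsilon>"
proof (rule ccontr)
  assume "\<not> thesis"
  then have far: "\<epsilon> \<le> (\<Sum>i\<in>I. (\<phi> i x - c i)\<^sup>2)" if "x \<in> C" for x
    using that \<open>\<not> thesis\<close> \<open>\<And>x. x \<in> C \<Longrightarrow> (\<Sum>i\<in>I. (\<phi> i x - c i)\<^sup>2) < \<epsilon> \<Longrightarrow> thesis\<close> not_le by blast
  define Q where "Q x = (\<Sum>i\<in>I. (\<phi> i x - c i)\<^sup>2)" for x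
  define d where "d = Inf (Q ` C)"
  have bddQ: "bdd_below (Q ` C)" using far by (auto simp: Q_def intro!: bdd_belowI2)
  have d: "\<epsilon> \<le> d" unfolding d_def using C(2) far by (intro cINF_greatest) (auto simp: Q_def)
  have dQ: "d \<le> Q x" if "x \<in> C" for x unfolding d_def by (rule cINF_lower[OF bddQ that])
  define T where "T = (\<Sum>i\<in>I. (2 * R i)\<^sup>2)"
  have T0: "0 \<le> T" unfolding T_def by (simp add: sum_nonneg)
  \<comment> \<open>\<open>T\<close> bounds the squared diameter of the image of \<open>C\<close>.
    This step length keeps the quadratic term of \<open>Q\<close> along a segment in
    \<open>C\<close> below \<open>\<tau> * d / 2\<close>, which is also the accuracy required of the
    near-minimiser \<open>x\<close>.\<close>
  define \<tau> where "\<tau> = min 1 (d / (2 * (T + 1)))"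
  have \<tau>: "0 < \<tau>" "\<tau> \<le> 1" using d \<epsilon> T0 by (simp_all add: \<tau>_def)
  have "\<tau> \<le> d / (2 * (T + 1))" by (simp add: \<tau>_def)
  then have "\<tau> * (T + 1) \<le> d / 2" using T0 by (simp add: field_simps)
  then have \<tau>T: "\<tau> * T \<le> d / 2" using \<tau>(1) by (simp add: algebra_simps)
  have "d < d + \<tau> * d / 2" using d \<epsilon> \<tau>(1) by simp
  then obtain x where x: "x \<in> C" "Q x < d + \<tau> * d / 2"
    using cINF_less_iff[OF C(2) bddQ] unfolding d_def by blast
  \<comment> \<open>The separating coefficients point from the image of \<open>x\<close> to the
    target. Comparing \<open>Q\<close> at \<open>x\<close> and at
    \<open>x + \<tau> *\<^sub>R (y - x)\<close> shows that no \<open>y\<close> in \<open>C\<close>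
    gains more than \<open>d / 2\<close> over \<open>x\<close>, whereas the target gains
    \<open>Q x\<close>, which is at least \<open>d\<close>.\<close>
  have "(\<Sum>i\<in>I. (c i - \<phi> i x) * \<phi> i y) \<le> d / 2 + (\<Sum>i\<in>I. (c i - \<phi> i x) * \<phi> i x)" if y: "y \<in> C" for y
  proof -
    define S where "S = (\<Sum>i\<in>I. (\<phi> i x - c i) * (\<phi> i y - \<phi> i x))"
    define W where "W = (\<Sum>i\<in>I. (\<phi> i y - \<phi> i x)\<^sup>2)"
    have "W \<le> T" unfolding W_def T_def
    proof (rule sum_mono)
      fix i assume i: "i \<in> I"
      have "\<bar>\<phi> i y - \<phi> i x\<bar> \<le> 2 * R i" using bdd[OF i y] bdd[OF i x(1)] by linarith
      then show "(\<phi> i y - \<phi> i x)\<^sup>2 \<le> (2 * R i)\<^sup>2"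
        using abs_le_square_iff[of "\<phi> i y - \<phi> i x" "2 * R i"] by linarith
    qed
    have "x + \<tau> *\<^sub>R (y - x) = (1 - \<tau>) *\<^sub>R x + \<tau> *\<^sub>R y" by (simp add: algebra_simps)
    then have "x + \<tau> *\<^sub>R (y - x) \<in> C"
      using C(1) x(1) y \<tau> by (simp add: convex_alt)
    then have "d \<le> Q (x + \<tau> *\<^sub>R (y - x))" by (rule dQ)
    also have "\<dots> = (\<Sum>i\<in>I. (\<phi> i x - c i)\<^sup>2 + 2 * \<tau> * ((\<phi> i x - c i) * (\<phi> i y - \<phi> i x)) + \<tau>\<^sup>2 * (\<phi> i y - \<phi> i x)\<^sup>2)"
      unfolding Q_def
      by (intro sum.cong refl) (simp add: linear_add[OF lin] linear_diff[OF lin] linear_scale[OF lin] power2_eq_square algebra_simps)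
    also have "\<dots> = Q x + 2 * \<tau> * S + \<tau>\<^sup>2 * W"
      by (simp add: Q_def S_def W_def sum.distrib sum_distrib_left)
    finally have "0 \<le> \<tau> * d / 2 + 2 * \<tau> * S + \<tau>\<^sup>2 * W" using x(2) by linarith
    also have "\<dots> \<le> \<tau> * d / 2 + 2 * \<tau> * S + \<tau> * (d / 2)"
    proof -
      have "\<tau> * W \<le> d / 2" using mult_left_mono[OF \<open>W \<le> T\<close>, of \<tau>] \<tau> \<tau>T by linarith
      from mult_left_mono[OF this, of \<tau>] have "\<tau>\<^sup>2 * W \<le> \<tau> * (d / 2)"
        using \<tau>(1) by (simp only: power2_eq_square mult.assoc)
      then show ?thesis by (rule add_left_mono)
    qed
    also have "\<dots> = \<tau> * (d + 2 * S)" by (simp add: algebra_simps)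
    finally have "- S \<le> d / 2" using \<tau>(1) by (simp add: zero_le_mult_iff)
    moreover have "- S = (\<Sum>i\<in>I. (c i - \<phi> i x) * \<phi> i y) - (\<Sum>i\<in>I. (c i - \<phi> i x) * \<phi> i x)"
      unfolding S_def sum_negf[symmetric] sum_subtractf[symmetric]
      by (intro sum.cong refl) (simp add: algebra_simps)
    ultimately show ?thesis by linarith
  qed
  from dom[OF this]
  have "(\<Sum>i\<in>I. (c i - \<phi> i x) * c i) - (\<Sum>i\<in>I. (c i - \<phi> i x) * \<phi> i x) \<le> d / 2" by simp
  moreover have "(\<Sum>i\<in>I. (c i - \<phi> i x) * c i) - (\<Sum>i\<in>I. (c i - \<phi> i x) * \<phi> i x) = Q x"
    unfolding Q_def sum_subtractf[symmetric]
    by (intro sum.cong refl) (simp add: power2_eq_square algebra_simps)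
  ultimately show False using dQ[OF x(1)] d \<epsilon> by linarith
qed

text \<open>Prescribing a bound for every seminorm gives bounded sets that are convex and closed
  under negation, as the separation argument requires. A negative bound can make the set empty, so
  membership of 0 is recorded where it matters.\<close>

definition sym_bounded_set ::
  "(nat \<Rightarrow> ('d::finite, 'n::finite) config set \<Rightarrow> real) \<Rightarrow> ('d, 'n) sym_smooth set" where
  "sym_bounded_set M = {f. \<forall>m L. compact L \<longrightarrow> L \<noteq> {} \<longrightarrow> sym_seminorm m L f \<le> M m L}"

lemma sym_bounded_setD:
  "f \<in> sym_bounded_set M \<Longrightarrow> compact L \<Longrightarrow> L \<noteq> {} \<Longrightarrow> sym_seminorm m L f \<le> M m L"
  by (simp add: sym_bounded_set_def)

context
  fixes L :: "('d::finite, 'n::finite) config set"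
  assumes L: "compact L" "L \<noteq> {}"
begin

lemma sym_seminorm_triangle: "sym_seminorm m L (f + g) \<le> sym_seminorm m L f + sym_seminorm m L g"
  using sym_seminorm_is_seminorm[OF L, of m] unfolding is_seminorm_def by blast

lemma sym_seminorm_scaleR: "sym_seminorm m L (c *\<^sub>R f) = \<bar>c\<bar> * sym_seminorm m L f"
  using sym_seminorm_is_seminorm[OF L, of m] unfolding is_seminorm_def by blast

lemma sym_seminorm_uminus: "sym_seminorm m L (- f) = sym_seminorm m L f"
  by (rule is_seminorm_minus[OF sym_seminorm_is_seminorm[OF L]])

end

lemma convex_sym_bounded_set: "convex (sym_bounded_set M)"
proof (rule convexI)
  fix f g :: "('a, 'b) sym_smooth" and s t :: real
  assume fg: "f \<in> sym_bounded_set M" "g \<in> sym_bounded_set M" and st: "0 \<le> s" "0 \<le> t" "s + t = 1"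
  have "sym_seminorm m L (s *\<^sub>R f + t *\<^sub>R g) \<le> M m L" if L: "compact L" "L \<noteq> {}" for m L
  proof -
    have "sym_seminorm m L (s *\<^sub>R f + t *\<^sub>R g) \<le> s * sym_seminorm m L f + t * sym_seminorm m L g"
      using sym_seminorm_triangle[OF L, of m "s *\<^sub>R f" "t *\<^sub>R g"] st by (simp add: sym_seminorm_scaleR[OF L])
    also have "\<dots> \<le> s * M m L + t * M m L"
      by (intro add_mono mult_left_mono sym_bounded_setD fg L st)
    also have "\<dots> = M m L" using st(3) by (simp flip: distrib_right)
    finally show ?thesis .
  qed
  then show "s *\<^sub>R f + t *\<^sub>R g \<in> sym_bounded_set M" by (simp add: sym_bounded_set_def)
qed

lemma uminus_sym_bounded_set: "f \<in> sym_bounded_set M \<Longrightarrow> - f \<in> sym_bounded_set M"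
  by (simp add: sym_bounded_set_def sym_seminorm_uminus)

lemma pairing_sym_bounded_set:
  obtains R where "\<And>f. f \<in> sym_bounded_set M \<Longrightarrow> \<bar>pairing \<gamma> f\<bar> \<le> R"
proof -
  obtain J c where J: "finite J" "J \<subseteq> UNIV \<times> {K. compact K \<and> K \<noteq> {}}" "0 < c"
      "\<And>f. \<bar>pairing \<gamma> f\<bar> \<le> c * (\<Sum>(n, K)\<in>J. sym_seminorm n K f)"
    using pairing_sym_smooth_bound[of \<gamma>] by blast
  have "\<bar>pairing \<gamma> f\<bar> \<le> c * (\<Sum>(n, K)\<in>J. M n K)" if f: "f \<in> sym_bounded_set M" for f
  proof -
    have "(\<Sum>(n, K)\<in>J. sym_seminorm n K f) \<le> (\<Sum>(n, K)\<in>J. M n K)"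
      by (rule sum_mono) (use J(2) in \<open>auto intro!: sym_bounded_setD[OF f]\<close>)
    then show ?thesis using J(3) order_trans[OF J(4)] by (simp add: mult_left_mono)
  qed
  then show thesis by (rule that)
qed

text \<open>On a bounded set finitely many point values control a distribution: it is dominated by
  finitely many seminorms, and each of them is small once \<open>u\<close> is small on a suitable
  finite set.\<close>

lemma pairing_small:
  fixes \<gamma> :: "('d::finite, 'n::finite) sym_smooth dual"
  assumes "0 < \<epsilon>"
  obtains \<delta> Z where "0 < \<delta>" "finite Z"
    "\<And>u. u \<in> sym_bounded_set M \<Longrightarrow> \<forall>z\<in>Z. \<bar>apply_sym u z\<bar> \<le> \<delta> \<Longrightarrow> \<bar>pairing \<gamma> u\<bar> \<le> \<epsilon>"
proof -
  obtain J c where J: "finite J" "J \<subseteq> UNIV \<times> {K. compact K \<and> K \<noteq> {}}" "0 < c"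
      "\<And>f. \<bar>pairing \<gamma> f\<bar> \<le> c * (\<Sum>(n, K)\<in>J. sym_seminorm n K f)"
    using pairing_sym_smooth_bound[of \<gamma>] by blast
  define a where "a = c * (real (card J) + 1)"
  have a: "0 < a" using J(3) by (simp add: a_def add_nonneg_pos)
  define \<eta> where "\<eta> = \<epsilon> / a"
  have \<eta>: "0 < \<eta>" using a assms by (simp add: \<eta>_def)
  have "\<forall>j\<in>J. \<exists>\<delta> Z. 0 < \<delta> \<and> finite Z \<and> (\<forall>u\<in>sym_bounded_set M.
      (\<forall>z\<in>Z. \<bar>apply_sym u z\<bar> \<le> \<delta>) \<longrightarrow> sym_seminorm (fst j) (snd j) u \<le> \<eta>)"
  proof
    fix j assume "j \<in> J"
    then have "compact (snd j)" "snd j \<noteq> {}" using J(2) by auto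
    from sym_seminorm_small[OF this \<eta>, of M "fst j"]
    show "\<exists>\<delta> Z. 0 < \<delta> \<and> finite Z \<and> (\<forall>u\<in>sym_bounded_set M.
      (\<forall>z\<in>Z. \<bar>apply_sym u z\<bar> \<le> \<delta>) \<longrightarrow> sym_seminorm (fst j) (snd j) u \<le> \<eta>)"
      unfolding sym_bounded_set_def by blast
  qed
  then obtain \<delta> Z where \<delta>: "\<And>j. j \<in> J \<Longrightarrow> 0 < \<delta> j" "\<And>j. j \<in> J \<Longrightarrow> finite (Z j)"
    "\<And>j u. j \<in> J \<Longrightarrow> u \<in> sym_bounded_set M \<Longrightarrow> (\<forall>z\<in>Z j. \<bar>apply_sym u z\<bar> \<le> \<delta> j) \<Longrightarrow>
      sym_seminorm (fst j) (snd j) u \<le> \<eta>"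
    by metis
  \<comment> \<open>The inserted 1 gives the minimum a value when \<open>J\<close> is empty.\<close>
  let ?\<delta> = "Min (insert 1 (\<delta> ` J))"
  show thesis
  proof (rule that[of ?\<delta> "\<Union>j\<in>J. Z j"])
    show "0 < ?\<delta>" using J(1) \<delta>(1) by simp
    show "finite (\<Union>j\<in>J. Z j)" using J(1) \<delta>(2) by simp
    fix u assume u: "u \<in> sym_bounded_set M"
      and small: "\<forall>z\<in>(\<Union>j\<in>J. Z j). \<bar>apply_sym u z\<bar> \<le> ?\<delta>"
    have "sym_seminorm (fst j) (snd j) u \<le> \<eta>" if j: "j \<in> J" for j
    proof (rule \<delta>(3)[OF j u], rule)
      fix z assume "z \<in> Z j"
      then have "\<bar>apply_sym u z\<bar> \<le> ?\<delta>" using j by (intro small[rule_format]) auto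
      also have "?\<delta> \<le> \<delta> j" using j J(1) by (intro Min_le) auto
      finally show "\<bar>apply_sym u z\<bar> \<le> \<delta> j" .
    qed
    then have "(\<Sum>(n, K)\<in>J. sym_seminorm n K u) \<le> real (card J) * \<eta>"
      using sum_bounded_above[of J "\<lambda>(n, K). sym_seminorm n K u" \<eta>] by (auto simp: case_prod_unfold)
    then have "\<bar>pairing \<gamma> u\<bar> \<le> c * (real (card J) * \<eta>)"
      using J(3) by (intro order_trans[OF J(4)] mult_left_mono) auto
    also have "\<dots> \<le> c * ((real (card J) + 1) * \<eta>)"
      using J(3) \<eta> by (intro mult_left_mono mult_right_mono) auto
    also have "\<dots> = \<epsilon>" using a by (simp add: \<eta>_def a_def[symmetric] mult.assoc[symmetric])
    finally show "\<bar>pairing \<gamma> u\<bar> \<le> \<epsilon>" .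
  qed
qed

text \<open>Continuity of \<open>\<Phi>\<close> involves finitely many bounded sets and a constant.
  A single set of prescribed bounds contains them all, and enlarging it absorbs the constant, so
  that \<open>\<Phi>\<close> lies in its bipolar.\<close>

lemma bidual_bounded_by_set:
  fixes \<Phi> :: "('d::finite, 'n::finite) sym_smooth dual dual"
  obtains M where "0 \<in> sym_bounded_set M"
    "\<And>\<gamma> \<beta>. (\<And>f. f \<in> sym_bounded_set M \<Longrightarrow> \<bar>pairing \<gamma> f\<bar> \<le> \<beta>) \<Longrightarrow> \<bar>pairing \<Phi> \<gamma>\<bar> \<le> \<beta>"
proof -
  obtain J c where J: "finite J" "J \<subseteq> {B. tvs_bounded B \<and> B \<noteq> {}}" "0 < c"
      "\<And>\<gamma>. \<bar>pairing \<Phi> \<gamma>\<bar> \<le> c * (\<Sum>B\<in>J. dual_seminorm B \<gamma>)"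
    using pairing_dual_bound[of \<Phi>] by blast
  have "\<exists>R\<ge>0. \<forall>B\<in>J. \<forall>f\<in>B. compact L \<longrightarrow> L \<noteq> {} \<longrightarrow> sym_seminorm m L f \<le> R" for m L
  proof (cases "compact L \<and> L \<noteq> {}")
    case True
    have "\<exists>R>0. \<forall>f\<in>B. sym_seminorm m L f \<le> R" if "B \<in> J" for B
    proof -
      have "tvs_bounded B" using J(2) that by auto
      then obtain R where "0 < R" "\<And>f. f \<in> B \<Longrightarrow> sym_seminorm m L f \<le> R"
        using tvs_bounded_sym_seminorm[of B L m] True by blast
      then show ?thesis by blast
    qed
    then obtain R where R: "\<And>B. B \<in> J \<Longrightarrow> 0 < R B" "\<And>B f. B \<in> J \<Longrightarrow> f \<in> B \<Longrightarrow> sym_seminorm m L f \<le> R B"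
      by metis
    have "sym_seminorm m L f \<le> (\<Sum>B\<in>J. R B)" if "B \<in> J" "f \<in> B" for B f
    proof -
      have "R B \<le> (\<Sum>B\<in>J. R B)"
        by (rule member_le_sum[OF that(1) _ J(1)]) (use R(1) in \<open>auto intro: less_imp_le\<close>)
      then show ?thesis using R(2)[OF that] by linarith
    qed
    moreover have "0 \<le> (\<Sum>B\<in>J. R B)" using R(1) by (simp add: less_imp_le sum_nonneg)
    ultimately show ?thesis by blast
  qed auto
  then have "\<exists>R. \<forall>m L. 0 \<le> R m L \<and> (\<forall>B\<in>J. \<forall>f\<in>B. compact L \<longrightarrow> L \<noteq> {} \<longrightarrow> sym_seminorm m L f \<le> R m L)"
    by (intro choice allI)
  then obtain R where R: "\<And>m L. 0 \<le> R m L"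
    "\<And>m L B f. B \<in> J \<Longrightarrow> f \<in> B \<Longrightarrow> compact L \<Longrightarrow> L \<noteq> {} \<Longrightarrow> sym_seminorm m L f \<le> R m L"
    by blast
  \<comment> \<open>Since \<open>k *\<^sub>R f\<close> lies in \<open>?C\<close> for
    \<open>f\<close> in any \<open>B\<close> of \<open>J\<close>, each dual seminorm is at most
    \<open>\<beta> / k\<close>, and the total is at most \<open>(k - 1) * \<beta> / k\<close>. The
    summand 1 also keeps \<open>k\<close> positive for empty \<open>J\<close>.\<close>
  define k where "k = c * card J + 1"
  have k: "0 < k" using J(3) by (simp add: k_def add_nonneg_pos)
  let ?C = "sym_bounded_set (\<lambda>m L. k * R m L)"
  have zero: "0 \<in> ?C"
    using R(1) k by (auto simp: sym_bounded_set_def is_seminorm_zero[OF sym_seminorm_is_seminorm])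
  have "\<bar>pairing \<Phi> \<gamma>\<bar> \<le> \<beta>" if bd: "\<And>f. f \<in> ?C \<Longrightarrow> \<bar>pairing \<gamma> f\<bar> \<le> \<beta>" for \<gamma> \<beta>
  proof -
    have \<beta>: "0 \<le> \<beta>" using bd[OF zero] by linarith
    have "dual_seminorm B \<gamma> \<le> \<beta> / k" if B: "B \<in> J" for B
    proof (rule dual_seminorm_leI)
      show "B \<noteq> {}" using J(2) B by auto
      fix f assume f: "f \<in> B"
      have "k *\<^sub>R f \<in> ?C"
        using R(2)[OF B f] k by (simp add: sym_bounded_set_def sym_seminorm_scaleR)
      from bd[OF this] have "k * \<bar>pairing \<gamma> f\<bar> \<le> \<beta>"
        using k by (simp add: linear_scale[OF pairing_linear] abs_mult)
      then show "\<bar>pairing \<gamma> f\<bar> \<le> \<beta> / k" using k by (simp add: field_simps)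
    qed
    then have "(\<Sum>B\<in>J. dual_seminorm B \<gamma>) \<le> real (card J) * (\<beta> / k)"
      using sum_bounded_above[of J "\<lambda>B. dual_seminorm B \<gamma>" "\<beta> / k"] by auto
    then have "\<bar>pairing \<Phi> \<gamma>\<bar> \<le> c * (real (card J) * (\<beta> / k))"
      using J(3) by (intro order_trans[OF J(4)] mult_left_mono) auto
    also have "\<dots> = (k - 1) * \<beta> / k" by (simp add: k_def)
    also have "\<dots> \<le> \<beta>" using k \<beta> by (simp add: field_simps)
    finally show ?thesis .
  qed
  with zero show thesis by (rule that)
qed

text \<open>The values are forced on any representative of \<open>\<Phi>\<close>, because evaluation
  at \<open>z\<close> is pairing with the Dirac mass. The function is smooth because the continuous
  linear \<open>\<Phi>\<close> commutes with the limits defining the derivatives of Dirac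
  masses.\<close>

lift_definition bidual_sym :: "('d::finite, 'n::finite) sym_smooth dual dual \<Rightarrow> ('d, 'n) sym_smooth"
  is "\<lambda>\<Phi> z. pairing \<Phi> (dirac_tensor z)"
proof (intro conjI allI impI)
  fix \<Phi> :: "('d, 'n) sym_smooth dual dual"
  let ?D = "\<lambda>hs z. pairing \<Phi> (dirac_deriv hs z)"
  have nil: "?D [] z = pairing \<Phi> (dirac_tensor z)" for z by (simp only: dirac_deriv_Nil)
  have deriv: "has_gateaux_deriv (?D hs) z h (?D (h # hs) z)" for hs z h
    unfolding has_gateaux_deriv_def
    using continuous_on_tendsto_compose[OF pairing_continuous
        has_gateaux_deriv_dirac_deriv[of hs z h, unfolded has_gateaux_deriv_def], of \<Phi>]
    by (simp add: linear_scale[OF pairing_linear] linear_diff[OF pairing_linear])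
  have cont: "continuous_on UNIV (\<lambda>p. ?D (map (snd p) [0..<n]) (fst p))" for n
    using continuous_on_compose2[OF pairing_continuous continuous_on_dirac_deriv_map[of "[0..<n]" "[]"] subset_UNIV]
    by simp
  show "gateaux_smooth (\<lambda>z. pairing \<Phi> (dirac_tensor z))"
    by (rule gateaux_smoothI(1)[OF nil deriv cont])
qed (simp add: dirac_tensor_permute)

theorem semireflexive_sym_smooth:
  fixes \<Phi> :: "('d::finite, 'n::finite) sym_smooth dual dual"
  shows "to_bidual (bidual_sym \<Phi>) = \<Phi>"
proof (rule dual_eqI)
  fix \<gamma> :: "('d, 'n) sym_smooth dual"
  define g where "g = bidual_sym \<Phi>"
  obtain M where M: "0 \<in> sym_bounded_set M"
      "\<And>\<gamma> \<beta>. (\<And>f. f \<in> sym_bounded_set M \<Longrightarrow> \<bar>pairing \<gamma> f\<bar> \<le> \<beta>) \<Longrightarrow> \<bar>pairing \<Phi> \<gamma>\<bar> \<le> \<beta>"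
    by (rule bidual_bounded_by_set[of \<Phi>]) blast
  have "\<forall>\<gamma>. \<exists>R. \<forall>f\<in>sym_bounded_set M. \<bar>pairing \<gamma> f\<bar> \<le> R"
    by (rule allI, rule pairing_sym_bounded_set) blast
  then obtain R where R: "\<And>\<gamma> f. f \<in> sym_bounded_set M \<Longrightarrow> \<bar>pairing \<gamma> f\<bar> \<le> R \<gamma>"
    by (elim choice[THEN exE]) blast
  have "\<bar>pairing \<gamma> g - pairing \<Phi> \<gamma>\<bar> \<le> \<epsilon>" if \<epsilon>: "0 < \<epsilon>" for \<epsilon>
  proof -
    \<comment> \<open>The bounds are enlarged by the seminorms of \<open>g\<close>, since the lemma
      is applied to \<open>f - g\<close> with \<open>f\<close> in the set for \<open>M\<close>, to
      which \<open>g\<close> is not known to belong.\<close>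
    obtain \<delta> Z where \<delta>: "0 < \<delta>" "finite Z"
      "\<And>u. u \<in> sym_bounded_set (\<lambda>m L. M m L + sym_seminorm m L g) \<Longrightarrow>
        \<forall>z\<in>Z. \<bar>apply_sym u z\<bar> \<le> \<delta> \<Longrightarrow> \<bar>pairing \<gamma> u\<bar> \<le> \<epsilon> / 2"
      using pairing_small[OF half_gt_zero[OF \<epsilon>], of "\<lambda>m L. M m L + sym_seminorm m L g" \<gamma>] by blast
    define I where "I = insert \<gamma> (dirac_tensor ` Z)"
    define e where "e = min \<delta> (\<epsilon> / 2)"
    have e: "0 < e" using \<delta>(1) \<epsilon> by (simp add: e_def)
    have fin: "finite I" using \<delta>(2) by (simp add: I_def)
    \<comment> \<open>A one-sided bound on the set becomes two-sided because the set is closed under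
      negation; then the bipolar property of \<open>\<Phi>\<close> applies to the linear combination
      of distributions.\<close>
    have dom: "(\<Sum>i\<in>I. a i * pairing \<Phi> i) \<le> \<beta>"
      if bd: "\<And>f. f \<in> sym_bounded_set M \<Longrightarrow> (\<Sum>i\<in>I. a i * pairing i f) \<le> \<beta>" for a \<beta>
    proof -
      let ?\<gamma> = "\<Sum>i\<in>I. a i *\<^sub>R i"
      have eq: "pairing ?\<gamma> f = (\<Sum>i\<in>I. a i * pairing i f)" for f
        by (simp add: pairing_sum scaleR_dual.rep_eq)
      have "\<bar>pairing ?\<gamma> f\<bar> \<le> \<beta>" if "f \<in> sym_bounded_set M" for f
        using bd[OF that] bd[OF uminus_sym_bounded_set[OF that]] linear_neg[OF pairing_linear[of ?\<gamma>], of f]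
        unfolding eq[symmetric] by linarith
      from M(2)[OF this] show ?thesis
        by (simp add: linear_sum[OF pairing_linear] linear_scale[OF pairing_linear])
    qed
    obtain f where f: "f \<in> sym_bounded_set M" "(\<Sum>i\<in>I. (pairing i f - pairing \<Phi> i)\<^sup>2) < e\<^sup>2"
      by (rule convex_approximation[where \<phi> = pairing and C = "sym_bounded_set M" and R = R and c = "pairing \<Phi>" and \<epsilon> = "e\<^sup>2"])
        (use fin pairing_linear convex_sym_bounded_set M(1) R dom e in \<open>auto\<close>)
    have close: "\<bar>pairing i f - pairing \<Phi> i\<bar> \<le> e" if i: "i \<in> I" for i
    proof -
      have "(pairing i f - pairing \<Phi> i)\<^sup>2 \<le> (\<Sum>i\<in>I. (pairing i f - pairing \<Phi> i)\<^sup>2)"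
        by (rule member_le_sum[OF i _ fin]) simp
      then have "(pairing i f - pairing \<Phi> i)\<^sup>2 \<le> e\<^sup>2" using f(2) by linarith
      then show ?thesis using e by (simp add: abs_le_square_iff[symmetric])
    qed
    have "f - g \<in> sym_bounded_set (\<lambda>m L. M m L + sym_seminorm m L g)"
      unfolding sym_bounded_set_def
    proof (intro CollectI allI impI)
      fix m and L :: "('d, 'n) config set" assume L: "compact L" "L \<noteq> {}"
      show "sym_seminorm m L (f - g) \<le> M m L + sym_seminorm m L g"
        using sym_seminorm_triangle[OF L, of m f "- g"] sym_bounded_setD[OF f(1) L, of m]
        by (simp add: sym_seminorm_uminus[OF L])
    qed
    \<comment> \<open>Closeness on the Dirac masses in \<open>I\<close> is closeness of
      \<open>f\<close> to \<open>g\<close> on \<open>Z\<close>, as \<open>g\<close> takes the values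
      of \<open>\<Phi>\<close> there.\<close>
    moreover have "\<forall>z\<in>Z. \<bar>apply_sym (f - g) z\<bar> \<le> \<delta>"
    proof
      fix z assume "z \<in> Z"
      then have "\<bar>apply_sym f z - pairing \<Phi> (dirac_tensor z)\<bar> \<le> e"
        using close[of "dirac_tensor z"] by (simp add: I_def dirac_tensor.rep_eq)
      then show "\<bar>apply_sym (f - g) z\<bar> \<le> \<delta>"
        by (simp add: minus_sym_smooth.rep_eq g_def bidual_sym.rep_eq e_def)
    qed
    ultimately have "\<bar>pairing \<gamma> (f - g)\<bar> \<le> \<epsilon> / 2" by (rule \<delta>(3))
    moreover have "\<bar>pairing \<gamma> f - pairing \<Phi> \<gamma>\<bar> \<le> \<epsilon> / 2" using close[of \<gamma>] by (simp add: I_def e_def)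
    ultimately show ?thesis unfolding linear_diff[OF pairing_linear] by linarith
  qed
  then have "\<bar>pairing \<gamma> g - pairing \<Phi> \<gamma>\<bar> \<le> 0" by (rule field_le_epsilon[of _ 0, simplified])
  then show "pairing (to_bidual (bidual_sym \<Phi>)) \<gamma> = pairing \<Phi> \<gamma>"
    by (simp add: to_bidual.rep_eq g_def)
qed

section \<open>Inverting the canonical map into the bidual\<close>

lemma to_bidual_inject_sym_smooth:
  fixes f g :: "('d::finite, 'n::finite) sym_smooth"
  assumes "to_bidual f = to_bidual g"
  shows "f = g"
proof (rule sym_smooth_eqI)
  fix z
  have "pairing (to_bidual f) (dirac_tensor z) = pairing (to_bidual g) (dirac_tensor z)"
    using assms by simp
  then show "apply_sym f z = apply_sym g z" by (simp add: to_bidual.rep_eq dirac_tensor.rep_eq)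
qed

text \<open>The definite description in \<open>of_bidual\<close> denotes: existence is
  semireflexivity, and uniqueness holds because Dirac masses separate symmetric functions.\<close>

lemma pairing_of_bidual:
  fixes \<Phi> :: "('d::finite, 'n::finite) sym_smooth dual dual"
  shows "pairing \<gamma> (of_bidual \<Phi>) = pairing \<Phi> \<gamma>"
proof -
  have "of_bidual \<Phi> = bidual_sym \<Phi>"
    unfolding of_bidual_def
  proof (rule the_equality)
    show "to_bidual (bidual_sym \<Phi>) = \<Phi>" by (rule semireflexive_sym_smooth)
  next
    fix f assume "to_bidual f = \<Phi>"
    then show "f = bidual_sym \<Phi>"
      by (intro to_bidual_inject_sym_smooth) (simp only: semireflexive_sym_smooth)
  qed
  then have "pairing \<gamma> (of_bidual \<Phi>) = pairing (to_bidual (bidual_sym \<Phi>)) \<gamma>"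
    by (simp only: to_bidual.rep_eq)
  then show ?thesis by (simp only: semireflexive_sym_smooth)
qed

section \<open>The Poisson morphism\<close>

text \<open>The chain rule applies the differential of \<open>F\<close> to the derivative of the
  Dirac mass along \<open>h\<close>; pairing that derivative with the representing function
  differentiates this function at \<open>z\<close>.\<close>

lemma gateaux_deriv_dirac_tensor:
  fixes F :: "('d::finite, 'n::finite) sym_smooth dual \<Rightarrow> real"
  assumes F: "gateaux_smooth F"
  shows "gateaux_deriv (F \<circ> dirac_tensor) z h =
    gateaux_deriv (apply_sym (of_bidual (gateaux_differential F (dirac_tensor z)))) z h"
proof -
  let ?f = "of_bidual (gateaux_differential F (dirac_tensor z))"
  have "has_gateaux_deriv dirac_tensor z h (dirac_deriv [h] z)"
    using has_gateaux_deriv_dirac_deriv[of "[]" z h] by (simp only: dirac_deriv_Nil)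
  from gateaux_deriv_compose[OF F this]
  have "gateaux_deriv (F \<circ> dirac_tensor) z h = pairing (dirac_deriv [h] z) ?f"
    by (simp add: pairing_of_bidual pairing_gateaux_differential[OF F])
  moreover have "iter_deriv (apply_sym ?f) [] = apply_sym ?f" by (rule ext) simp
  ultimately show ?thesis by (simp add: dirac_deriv.rep_eq)
qed

theorem proposition2p4:
  shows "gateaux_smooth (iota_Lio :: ('d::finite, 'n::finite) config \<Rightarrow> ('d, 'n) sym_smooth dual) \<and>
    (\<forall>F G :: ('d, 'n) sym_smooth dual \<Rightarrow> real. gateaux_smooth F \<longrightarrow> gateaux_smooth G \<longrightarrow>
       poisson_bracket (F \<circ> iota_Lio) (G \<circ> iota_Lio) = lie_poisson_bracket F G \<circ> iota_Lio)"
  unfolding iota_Lio_eq_dirac_tensor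
proof (intro conjI allI impI ext)
  show "gateaux_smooth (dirac_tensor :: ('d, 'n) config \<Rightarrow> _)" by (rule dirac_tensor_smooth)
next
  fix F G :: "('d, 'n) sym_smooth dual \<Rightarrow> real" and z
  assume "gateaux_smooth F" "gateaux_smooth G"
  \<comment> \<open>The representing functions depend on \<open>z\<close>, but the bracket at
    \<open>z\<close> sees only first derivatives there, so they may be held fixed while the
    gradients are compared.\<close>
  then show "poisson_bracket (F \<circ> dirac_tensor) (G \<circ> dirac_tensor) z = (lie_poisson_bracket F G \<circ> dirac_tensor) z"
    by (simp add: lie_poisson_bracket_def dirac_tensor.rep_eq lie_bracket.rep_eq poisson_bracket_def
        grad_x_def grad_v_def gateaux_deriv_dirac_tensor)
qed

end
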